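(* Let $\lambda$ be a continuous periodic intensity function on $\mathbb{R}^d$ satisfying $0<\lambda_{\min}:=\inf_t\lambda(t)\le\|\lambda\|_\infty<\infty$, and let $Y(dt)=\sum_{j\ge1}A_j\delta_{t_j}(dt)$ be the corresponding inhomogeneous, compound Poisson point process. Let $\gamma_k=(s_k,\xi_k)$ and $\gamma_k'=(s_k',\xi_k')$ be sequences of scale-frequency pairs with $s_k'=cs_k$ for some $c>0$, $\lim_{k\to\infty}s_k=0$, and $\lim_{k\to\infty}s_k'\xi_k'=L\in\mathbb{R}^d$. Let $1\le p,p'<\infty$ and $q=pp'$. Assume $\mathbb{E}|A_1|^q<\infty$, and let $$K:=\left\|g_{c,L/c}*|g_{1,0}|^p\right\|_{p'}^{p'}.$$ Then, for all $t\in\mathbb{R}^d$, $$\lim_{k\to\infty}\frac{S_{\gamma_k,p,\gamma_k',p'}Y(t)}{s_k^{d(p'+1)}}=K\,\lambda(t)\,\mathbb{E}[|A_1|^q],$$ and $$\lim_{k\to\infty}\frac{SY(\gamma_k,p,\gamma_k',p')}{s_k^{d(p'+1)}}=K\,m_1(\lambda)\,\mathbb{E}[|A_1|^q].$$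
   Context: Window and filters: $w\in L^2(\mathbb{R}^d)$ is a continuous function with support contained in $[0,1]^d$. For $\gamma=(s,\xi)$ with $s>0$, $\xi\in\mathbb{R}^d$, set $g_\gamma(t)=g_{s,\xi}(t)=w(t/s)e^{i\xi\cdot t}$, $t\in\mathbb{R}^d$. $\|\cdot\|_{p'}$ is the $L^{p'}(\mathbb{R}^d)$ norm and $*$ between functions is convolution on $\mathbb{R}^d$. Process: $\lambda$ is periodic with period $T>0$ along each coordinate, and $m_1(\lambda)=\frac1{T^d}\int_{[0,T]^d}\lambda(t)\,dt$. $\Lambda(B)=\int_B\lambda(u)\,du$ for Borel $B\subset\mathbb{R}^d$. $N(dt)=\sum_{j=1}^\infty\delta_{t_j}(dt)$ is an inhomogeneous Poisson point process with intensity $\lambda$: for Borel sets $B$, $P(N(B)=n)=e^{-\Lambda(B)}\Lambda(B)^n/n!$, and $N(B)$ is independent of $N(B')$ for all $B'$ that do not intersect $B$. $(A_j)_{j\ge1}$ is a sequence of i.i.d. random variables (charges) independent of $N$. $Y(dt)=\sum_{j=1}^\infty A_j\delta_{t_j}(dt)$. Scattering moments: for a function $f$, $(f*Y)(t)=\int_{\mathbb{R}^d}f(t-u)\,Y(du)=\sum_jA_jf(t-t_j)$. The second-order moments are $S_{\gamma,p,\gamma',p'}Y(t)=\mathbb{E}\left[\left|\left(|g_\gamma*Y|^p*g_{\gamma'}\right)(t)\right|^{p'}\right]$, and the time-invariant ones are $SY(\gamma,p,\gamma',p')=\frac1{T^d}\int_{[0,T]^d}S_{\gamma,p,\gamma',p'}Y(t)\,dt$.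 *)

theory Defs
  imports "HOL-Probability.Probability"
begin

(* The space R^d is an arbitrary type 'a of class euclidean_space, with d = DIM('a). *)

section \<open>Windows and filters\<close>

definition window :: "('a::euclidean_space \<Rightarrow> complex) \<Rightarrow> bool" where
  "window w \<longleftrightarrow>
     continuous_on UNIV w \<and>
     integrable lborel (\<lambda>t. (cmod (w t))\<^sup>2) \<and>
     closure {t. w t \<noteq> 0} \<subseteq> cbox 0 One"

definition gabor :: "('a::euclidean_space \<Rightarrow> complex) \<Rightarrow> real \<times> 'a \<Rightarrow> 'a \<Rightarrow> complex" where
  "gabor w \<gamma> t = w (t /\<^sub>R fst \<gamma>) * exp (\<i> * of_real (snd \<gamma> \<bullet> t))"

definition convolve ::
    "('a::euclidean_space \<Rightarrow> complex) \<Rightarrow> ('a \<Rightarrow> complex) \<Rightarrow> 'a \<Rightarrow> complex" where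
  "convolve f h t = (\<integral>u. f (t - u) * h u \<partial>lborel)"

(* The modulus power |f|^p, as a complex-valued function so that it can be convolved. *)
definition modpow :: "real \<Rightarrow> ('a \<Rightarrow> complex) \<Rightarrow> 'a \<Rightarrow> complex" where
  "modpow p f u = of_real (cmod (f u) powr p)"

definition Lp_norm :: "real \<Rightarrow> ('a::euclidean_space \<Rightarrow> complex) \<Rightarrow> real" where
  "Lp_norm p f = (\<integral>u. cmod (f u) powr p \<partial>lborel) powr (1 / p)"


section \<open>Periodic functions and averages over one period cube\<close>

definition coord_periodic :: "real \<Rightarrow> ('a::euclidean_space \<Rightarrow> real) \<Rightarrow> bool" where
  "coord_periodic T f \<longleftrightarrow> (\<forall>b\<in>Basis. \<forall>t. f (t + T *\<^sub>R b) = f t)"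

definition cube_mean :: "real \<Rightarrow> ('a::euclidean_space \<Rightarrow> real) \<Rightarrow> real" where
  "cube_mean T f = (1 / T ^ DIM('a)) * (LINT t:cbox 0 (T *\<^sub>R One)|lborel. f t)"


section \<open>Compound Poisson point processes\<close>

definition intensity_measure :: "('a::euclidean_space \<Rightarrow> real) \<Rightarrow> 'a measure" where
  "intensity_measure lam = density lborel (\<lambda>u. ennreal (lam u))"

(* The sum of the Dirac measures at x 0, x 1, x 2, ..., counting multiplicities,
   is the image of the counting measure on nat under x. *)
definition dirac_sum :: "(nat \<Rightarrow> 'a::euclidean_space) \<Rightarrow> 'a measure" where
  "dirac_sum x = distr (count_space UNIV) borel x"

(* Indices start at 0 instead of 1. If B has infinite intensity, the Poisson probability
   exp (-\<Lambda>(B)) \<Lambda>(B)^n / n! is read as 0, i.e. N(B) is infinite almost surely. *)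
locale poisson_point_process = prob_space M
  for M :: "'w measure" +
  fixes lam :: "'a::euclidean_space \<Rightarrow> real" and pt :: "nat \<Rightarrow> 'w \<Rightarrow> 'a"
  assumes random_points: "\<And>j. random_variable borel (pt j)"
    and poisson_counts:
      "\<And>B n. B \<in> sets borel \<Longrightarrow>
         prob {\<omega> \<in> space M. emeasure (dirac_sum (\<lambda>j. pt j \<omega>)) B = of_nat n} =
           (if emeasure (intensity_measure lam) B = \<infinity> then 0
            else exp (- measure (intensity_measure lam) B)
                   * measure (intensity_measure lam) B ^ n / fact n)"
    and indep_counts:
      "\<And>B B'. B \<in> sets borel \<Longrightarrow> B' \<in> sets borel \<Longrightarrow> B \<inter> B' = {} \<Longrightarrow>
         indep_var borel (\<lambda>\<omega>. emeasure (dirac_sum (\<lambda>j. pt j \<omega>)) B)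
                   borel (\<lambda>\<omega>. emeasure (dirac_sum (\<lambda>j. pt j \<omega>)) B')"

(* The charges are independent of the enumerated points pt 0, pt 1, ..., not merely of the
   random set of points: otherwise the enumeration could be chosen depending on the charges,
   and the law of the sum of the A j \<delta>_{pt j} would not be determined.  The library's
   indep_var needs both variables to have the same type, so independence is stated for the
   generated sigma-algebras. *)
locale compound_poisson_process = poisson_point_process M lam pt
  for M :: "'w measure" and lam :: "'a::euclidean_space \<Rightarrow> real" and pt :: "nat \<Rightarrow> 'w \<Rightarrow> 'a" +
  fixes A :: "nat \<Rightarrow> 'w \<Rightarrow> real"
  assumes indep_charges: "indep_vars (\<lambda>_. borel) A UNIV"
    and identically_distributed: "\<And>j. distr M borel (A j) = distr M borel (A 0)"
    and charges_indep_points: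
      "indep_set
         (sets (vimage_algebra (space M) (\<lambda>\<omega> j. A j \<omega>) (\<Pi>\<^sub>M j\<in>(UNIV::nat set). borel)))
         (sets (vimage_algebra (space M) (\<lambda>\<omega> j. pt j \<omega>) (\<Pi>\<^sub>M j\<in>(UNIV::nat set). borel)))"


section \<open>Scattering moments\<close>

(* (f * Y)(t) for the realisation Y of the process with charges a j at the points x j. *)
definition convolve_process ::
    "('a::euclidean_space \<Rightarrow> complex) \<Rightarrow> (nat \<Rightarrow> real) \<Rightarrow> (nat \<Rightarrow> 'a) \<Rightarrow> 'a \<Rightarrow> complex" where
  "convolve_process f a x t = (\<Sum>j. of_real (a j) * f (t - x j))"

definition scattering_moment ::
    "'w measure \<Rightarrow> (nat \<Rightarrow> 'w \<Rightarrow> 'a::euclidean_space) \<Rightarrow> (nat \<Rightarrow> 'w \<Rightarrow> real) \<Rightarrow> ('a \<Rightarrow> complex)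
       \<Rightarrow> real \<times> 'a \<Rightarrow> real \<Rightarrow> real \<times> 'a \<Rightarrow> real \<Rightarrow> 'a \<Rightarrow> real" where
  "scattering_moment M pt A w \<gamma> p \<gamma>' p' t =
     prob_space.expectation M
       (\<lambda>\<omega>. cmod (convolve
               (modpow p (convolve_process (gabor w \<gamma>) (\<lambda>j. A j \<omega>) (\<lambda>j. pt j \<omega>)))
               (gabor w \<gamma>') t) powr p')"

definition invariant_scattering_moment ::
    "'w measure \<Rightarrow> (nat \<Rightarrow> 'w \<Rightarrow> 'a::euclidean_space) \<Rightarrow> (nat \<Rightarrow> 'w \<Rightarrow> real) \<Rightarrow> ('a \<Rightarrow> complex)
       \<Rightarrow> real \<Rightarrow> real \<times> 'a \<Rightarrow> real \<Rightarrow> real \<times> 'a \<Rightarrow> real \<Rightarrow> real" where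
  "invariant_scattering_moment M pt A w T \<gamma> p \<gamma>' p' =
     cube_mean T (scattering_moment M pt A w \<gamma> p \<gamma>' p')"

end

theory Submission
  imports Defs
begin

text \<open>The value at t of the second-layer coefficient only depends on the points in the box B with
  sides (1 + c) s and upper corner t. If B contains exactly one point x, with charge a, the coefficient is
  explicit: rescaling by s turns it into \<open>s^d \<bar>a\<bar>^p\<close> times the profile
  \<open>g_{c, s \<xi>'} * \<bar>g_{1,0}\<bar>^p\<close> at (t - x) / s.
  Replacing the \<open>p'\<close>-th moment by the corresponding sum over all points in B costs an error which
  lives on the event that B contains at least two points and is at most
  \<open>C s^(d p') N(B)^m \<Sum> \<bar>A_j\<bar>^q\<close>. By the Poisson law its expectation is
  \<open>O(s^(d p') s^(2 d))\<close>, uniformly in t, whereas the sum itself has, by Campbell's formula, an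
  expectation of order \<open>s^(d p') s^d\<close>, whose rescaled limit is obtained by dominated convergence.\<close>

section \<open>Windows and the rescaled profile\<close>

text \<open>Conditioning on N(B) = 1 would require the law of the single point inside B. Summing the
  one-point values over all points of B avoids this: the sum is linear in the process, so its
  expectation involves only the mean measure and the mark moment. On N(B) >= 2 the powers p and p'
  destroy linearity, and a power of a sum over N(B) points costs a factor N(B)^m with an integer m
  >= q = p p'. This is why moments of the Poisson tail, and not merely its probability, are
  estimated. For a single point the modulus erases the phase of the first filter, so the first
  frequencies may vary arbitrarily. The second filter keeps its phase; after rescaling its frequency
  is s \<xi>' = s' \<xi>' / c, whence L/c in K. Random sums are treated as series over all indices
  with values in [0, infinity], where measurability and the exchange of sum and expectation are
  immediate. The null event of infinitely many points in B is dealt with only afterwards.\<close>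

lemma lborel_integral_affine_euclidean:
  fixes f :: "'a::euclidean_space \<Rightarrow> 'b::{banach, second_countable_topology}"
  assumes [measurable]: "f \<in> borel_measurable borel" and "c \<noteq> 0"
  shows "(\<integral>x. f x \<partial>lborel) = \<bar>c\<bar> ^ DIM('a) *\<^sub>R (\<integral>x. f (t + c *\<^sub>R x) \<partial>lborel)"
proof -
  have "(\<integral>x. f x \<partial>lborel)
      = (\<integral>x. f x \<partial>density (distr lborel borel (\<lambda>x. t + c *\<^sub>R x)) (\<lambda>_. ennreal (\<bar>c\<bar> ^ DIM('a))))"
    by (subst lborel_affine[OF \<open>c \<noteq> 0\<close>, of t]) simp
  also have "\<dots> = (\<integral>x. \<bar>c\<bar> ^ DIM('a) *\<^sub>R f x \<partial>distr lborel borel (\<lambda>x. t + c *\<^sub>R x))"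
    by (rule integral_density) auto
  also have "\<dots> = \<bar>c\<bar> ^ DIM('a) *\<^sub>R (\<integral>x. f (t + c *\<^sub>R x) \<partial>lborel)"
    by (subst integral_distr) auto
  finally show ?thesis .
qed

text \<open>Integrability of \<open>f\<close> is not a premise because a non-integrable function has
  Bochner integral 0. The bound thus applies to the convolution integrand of an arbitrary
  realisation without any measurability check.\<close>

lemma norm_integral_le_indicator:
  fixes f :: "'a \<Rightarrow> 'b::{banach, second_countable_topology}"
  assumes S: "S \<in> sets N" "emeasure N S < \<infinity>" and "0 \<le> C"
    and bd: "\<And>u. norm (f u) \<le> C * indicator S u"
  shows "norm (\<integral>u. f u \<partial>N) \<le> C * measure N S"
proof (cases "integrable N f")
  case True
  have "norm (\<integral>u. f u \<partial>N) \<le> (\<integral>u. norm (f u) \<partial>N)" by simp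
  also have "\<dots> \<le> (\<integral>u. C * indicator S u \<partial>N)"
    using True S bd by (intro integral_mono) auto
  also have "\<dots> = C * measure N S" using S by simp
  finally show ?thesis .
qed (simp add: not_integrable_integral_eq \<open>0 \<le> C\<close>)

section \<open>Bounds for windows and filters, and the limit of the profile\<close>

lemma window_support: "window w \<Longrightarrow> w t \<noteq> 0 \<Longrightarrow> t \<in> cbox 0 One"
  unfolding window_def using closure_subset[of "{t. w t \<noteq> 0}"] by auto

lemma window_measurable: "window w \<Longrightarrow> w \<in> borel_measurable borel"
  unfolding window_def by (simp add: borel_measurable_continuous_onI)

lemma window_bounded:
  fixes w :: "'a::euclidean_space \<Rightarrow> complex"
  assumes "window w"
  obtains D where "0 < D" "\<And>t. cmod (w t) \<le> D * indicator (cbox 0 One) t"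
proof -
  have "continuous_on (cbox 0 One) w"
    using assms continuous_on_subset unfolding window_def by blast
  then have "bounded (w ` cbox 0 One)"
    by (intro compact_imp_bounded compact_continuous_image compact_cbox)
  then obtain D where "0 < D" "\<And>t. t \<in> cbox 0 One \<Longrightarrow> cmod (w t) \<le> D"
    by (auto simp: bounded_pos)
  then have "cmod (w t) \<le> D * indicator (cbox 0 One) t" for t
    using window_support[OF assms, of t] by (cases "t \<in> cbox 0 One") auto
  with \<open>0 < D\<close> show ?thesis by (rule that)
qed

lemma scaleR_mem_cbox_One:
  fixes v :: "'a::euclidean_space"
  assumes "0 < s"
  shows "v /\<^sub>R s \<in> cbox 0 One \<longleftrightarrow> v \<in> cbox 0 (s *\<^sub>R One)"
proof -
  have "0 \<le> (v /\<^sub>R s) \<bullet> b \<and> (v /\<^sub>R s) \<bullet> b \<le> 1 \<longleftrightarrow> 0 \<le> v \<bullet> b \<and> v \<bullet> b \<le> s" for b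
    using assms by (simp add: field_simps)
  then show ?thesis by (simp add: mem_box)
qed

lemma content_cbox_scaleR_One:
  assumes "0 \<le> r"
  shows "measure lborel (cbox (x::'a::euclidean_space) (x + r *\<^sub>R One)) = r ^ DIM('a)"
proof -
  have "measure lborel (cbox x (x + r *\<^sub>R One)) = (\<Prod>b\<in>Basis. (x + r *\<^sub>R One) \<bullet> b - x \<bullet> b)"
    by (rule content_cbox) (use assms in \<open>simp add: inner_add_left\<close>)
  also have "\<dots> = (\<Prod>b\<in>(Basis::'a set). r)"
    by (intro prod.cong) (auto simp: inner_add_left)
  finally show ?thesis by simp
qed

lemma gabor_measurable [measurable]:
  assumes [measurable]: "w \<in> borel_measurable borel"
  shows "gabor w \<gamma> \<in> borel_measurable borel"
proof -
  have [measurable]: "(\<lambda>t. exp (\<i> * of_real (snd \<gamma> \<bullet> t))) \<in> borel_measurable borel"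
    by (intro borel_measurable_continuous_onI continuous_intros)
  show ?thesis unfolding gabor_def[abs_def] by measurable
qed

lemma cmod_gabor: "cmod (gabor w (s, \<xi>) t) = cmod (w (t /\<^sub>R s))"
  by (simp add: gabor_def norm_mult)

text \<open>The second-layer coefficient of a unit charge at unit scale. For \<eta> = L/c the
  integral of its modulus to the power p' is the constant K.\<close>

definition profile :: "('a::euclidean_space \<Rightarrow> complex) \<Rightarrow> real \<Rightarrow> real \<Rightarrow> 'a \<Rightarrow> 'a \<Rightarrow> complex" where
  "profile w p c \<eta> = convolve (gabor w (c, \<eta>)) (modpow p (gabor w (1, 0)))"

lemma profile_eq:
  "profile w p c \<eta> v = (\<integral>u. gabor w (c, \<eta>) (v - u) * of_real (cmod (w u) powr p) \<partial>lborel)"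
  by (simp add: profile_def convolve_def modpow_def cmod_gabor)

lemma profile_measurable [measurable]:
  assumes [measurable]: "w \<in> borel_measurable borel"
  shows "profile w p c \<eta> \<in> borel_measurable borel"
  unfolding profile_eq[abs_def] by measurable

text \<open>Substitute u = (t - x) - s y. The first window is then evaluated at y and the second
  filter at (t - x)/s - y, with frequency s \<xi>' and relative scale c; the Jacobian gives s^d. The
  modulus removes the first phase and turns the charge into the factor \<bar>a\<bar>^p.\<close>

lemma convolve_single_point:
  fixes w :: "'a::euclidean_space \<Rightarrow> complex"
  assumes [measurable]: "w \<in> borel_measurable borel" and "0 < s" "0 < c"
  shows "convolve (modpow p (\<lambda>v. of_real a * gabor w (s, \<xi>) (v - x))) (gabor w (c * s, \<xi>')) t
       = of_real (\<bar>a\<bar> powr p * s ^ DIM('a)) * profile w p c (s *\<^sub>R \<xi>') ((t - x) /\<^sub>R s)"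
proof -
  define f where "f u = (of_real ((\<bar>a\<bar> * cmod (w ((t - u - x) /\<^sub>R s))) powr p) :: complex) * gabor w (c * s, \<xi>') u" for u
  have [measurable]: "f \<in> borel_measurable borel"
    unfolding f_def[abs_def] by measurable
  have f_aff: "f ((t - x) + (- s) *\<^sub>R y) = of_real (\<bar>a\<bar> powr p) *
      (gabor w (c, s *\<^sub>R \<xi>') ((t - x) /\<^sub>R s - y) * of_real (cmod (w y) powr p))" for y
  proof -
    have e: "(t - ((t - x) + (- s) *\<^sub>R y) - x) /\<^sub>R s = y"
      using \<open>0 < s\<close> by (simp add: algebra_simps)
    have e2: "((t - x) + (- s) *\<^sub>R y) /\<^sub>R (c * s) = ((t - x) /\<^sub>R s - y) /\<^sub>R c"
      using \<open>0 < s\<close> \<open>0 < c\<close> by (simp add: algebra_simps)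
    have e3: "\<xi>' \<bullet> ((t - x) + (- s) *\<^sub>R y) = (s *\<^sub>R \<xi>') \<bullet> ((t - x) /\<^sub>R s - y)"
      using \<open>0 < s\<close> by (simp add: inner_diff_right inner_add_right field_simps)
    show ?thesis
      unfolding f_def gabor_def fst_conv snd_conv e e2 e3 by (simp add: powr_mult)
  qed
  have "convolve (modpow p (\<lambda>v. of_real a * gabor w (s, \<xi>) (v - x))) (gabor w (c * s, \<xi>')) t
      = (\<integral>u. f u \<partial>lborel)"
    by (simp add: convolve_def modpow_def f_def norm_mult cmod_gabor)
  also have "\<dots> = s ^ DIM('a) *\<^sub>R (\<integral>y. f ((t - x) + (- s) *\<^sub>R y) \<partial>lborel)"
    using lborel_integral_affine_euclidean[of f "- s" "t - x"] \<open>0 < s\<close> by simp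
  also have "\<dots> = of_real (\<bar>a\<bar> powr p * s ^ DIM('a)) * profile w p c (s *\<^sub>R \<xi>') ((t - x) /\<^sub>R s)"
    unfolding f_aff profile_eq by (simp add: scaleR_conv_of_real)
  finally show ?thesis .
qed

lemma gabor_le:
  assumes "\<And>t. cmod (w t) \<le> D * indicator (cbox 0 One) t" "0 < s"
  shows "cmod (gabor w (s, \<xi>) v) \<le> D * indicator (cbox 0 (s *\<^sub>R One)) v"
  using assms(1)[of "v /\<^sub>R s"] scaleR_mem_cbox_One[OF assms(2), of v]
  by (simp add: cmod_gabor indicator_def)

lemma gabor_support:
  assumes "\<And>t. cmod (w t) \<le> D * indicator (cbox 0 One) t" "0 < s" "gabor w (s, \<xi>) v \<noteq> 0"
  shows "v \<in> cbox 0 (s *\<^sub>R One)"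
proof (rule ccontr)
  assume "v \<notin> cbox 0 (s *\<^sub>R One)"
  then show False using gabor_le[OF assms(1,2), of \<xi> v] assms(3) by simp
qed

text \<open>The support in v is the sum of the boxes [0,1]^d and [0,c]^d. Modulation has modulus 1,
  so the bound does not depend on \<eta> and can dominate along a sequence of frequencies.\<close>

lemma profile_integrand_le:
  assumes D: "\<And>t. cmod (w t) \<le> D * indicator (cbox 0 One) t" "0 < D" and "0 < c" "0 \<le> p"
  shows "cmod (gabor w (c, \<eta>) (v - u) * of_real (cmod (w u) powr p))
    \<le> D * D powr p * indicator (cbox 0 ((1 + c) *\<^sub>R One)) v * indicator (cbox 0 One) u"
proof (cases "u \<in> cbox 0 One \<and> v - u \<in> cbox 0 (c *\<^sub>R One)")
  case True
  have "v \<in> cbox 0 ((1 + c) *\<^sub>R One)"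
    unfolding mem_box
  proof
    fix b :: 'a assume b: "b \<in> Basis"
    have "0 \<le> u \<bullet> b" "u \<bullet> b \<le> 1" "0 \<le> (v - u) \<bullet> b" "(v - u) \<bullet> b \<le> c"
      using True b by (auto simp: mem_box)
    then show "0 \<bullet> b \<le> v \<bullet> b \<and> v \<bullet> b \<le> ((1 + c) *\<^sub>R One) \<bullet> b"
      using b by (simp add: inner_diff_left distrib_right)
  qed
  moreover have "cmod (w u) powr p \<le> D powr p"
    using D(1)[of u] True \<open>0 \<le> p\<close> by (intro powr_mono2) auto
  moreover have "cmod (gabor w (c, \<eta>) (v - u)) \<le> D"
    using gabor_le[OF D(1) \<open>0 < c\<close>, of \<eta> "v - u"] True by simp
  ultimately show ?thesis
    using True D(2) by (simp add: norm_mult mult_mono)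
next
  case False
  then have "w u = 0 \<or> gabor w (c, \<eta>) (v - u) = 0"
    using D(1)[of u] gabor_le[OF D(1) \<open>0 < c\<close>, of \<eta> "v - u"] by auto
  then show ?thesis using D(2) by auto
qed

lemma profile_le:
  fixes w :: "'a::euclidean_space \<Rightarrow> complex"
  assumes D: "\<And>t. cmod (w t) \<le> D * indicator (cbox 0 One) t" "0 < D" and "0 < c" "0 \<le> p"
  shows "cmod (profile w p c \<eta> v) \<le> D * D powr p * indicator (cbox 0 ((1 + c) *\<^sub>R One)) v"
proof -
  have "cmod (profile w p c \<eta> v) \<le> D * D powr p * indicator (cbox 0 ((1 + c) *\<^sub>R One)) v * measure lborel (cbox (0::'a) One)"
    unfolding profile_eq
    by (rule norm_integral_le_indicator) (use profile_integrand_le[OF assms] D(2) in \<open>auto simp: emeasure_lborel_cbox_finite\<close>)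
  also have "measure lborel (cbox (0::'a) One) = 1"
    using content_cbox_scaleR_One[of 1 "0::'a"] by simp
  finally show ?thesis by simp
qed

text \<open>Only the frequency moves: the relative scale s'_k / s_k = c is constant, so the window
  factors are fixed and just the exponential has to converge.\<close>

lemma profile_tendsto:
  fixes w :: "'a::euclidean_space \<Rightarrow> complex"
  assumes "window w" "0 < c" "0 \<le> p" "\<eta> \<longlonglongrightarrow> \<eta>0"
  shows "(\<lambda>k. profile w p c (\<eta> k) v) \<longlonglongrightarrow> profile w p c \<eta>0 v"
proof -
  note [measurable] = window_measurable[OF assms(1)]
  obtain D where D: "0 < D" "\<And>t. cmod (w t) \<le> D * indicator (cbox 0 One) t"
    using window_bounded[OF assms(1)] by blast
  show ?thesis
    unfolding profile_eq
  proof (rule integral_dominated_convergence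
      [where w = "\<lambda>u. D * D powr p * indicator (cbox 0 ((1 + c) *\<^sub>R One)) v * indicator (cbox 0 One) u"])
    show "integrable lborel (\<lambda>u::'a. D * D powr p * indicator (cbox 0 ((1 + c) *\<^sub>R One)) v * indicator (cbox 0 One) u)"
      by (intro integrable_mult_right integrable_real_indicator) (auto simp: emeasure_lborel_cbox_finite)
    show "AE u in lborel. cmod (gabor w (c, \<eta> k) (v - u) * of_real (cmod (w u) powr p))
       \<le> D * D powr p * indicator (cbox 0 ((1 + c) *\<^sub>R One)) v * indicator (cbox 0 One) u" for k
      by (rule AE_I2) (rule profile_integrand_le[OF D(2,1) assms(2,3)])
    show "AE u in lborel. (\<lambda>k. gabor w (c, \<eta> k) (v - u) * of_real (cmod (w u) powr p))
       \<longlonglongrightarrow> gabor w (c, \<eta>0) (v - u) * of_real (cmod (w u) powr p)"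
      unfolding gabor_def fst_conv snd_conv
      by (rule AE_I2) (intro tendsto_intros assms(4))
  qed measurable
qed

text \<open>The sum is at most the number of terms times the largest term, and the q-th power of the
  latter is one of the summands on the right. The integer exponent \<open>m\<close> makes the
  prefactor an ordinary moment of the point count.\<close>

lemma sum_powr_le:
  fixes f :: "'i \<Rightarrow> real"
  assumes "finite J" "\<And>j. j \<in> J \<Longrightarrow> 0 \<le> f j" "1 \<le> q" "q \<le> real m"
  shows "(\<Sum>j\<in>J. f j) powr q \<le> real (card J) ^ m * (\<Sum>j\<in>J. f j powr q)"
proof (cases "J = {}")
  case False
  define x where "x = Max (f ` J)"
  have "x \<in> f ` J" unfolding x_def using assms(1) False by (intro Max_in) auto
  then obtain i where i: "i \<in> J" "x = f i" by auto
  have "f j \<le> x" if "j \<in> J" for j unfolding x_def using assms(1) that by simp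
  then have "(\<Sum>j\<in>J. f j) \<le> real (card J) * x"
    using sum_bounded_above[of J f x] by simp
  then have "(\<Sum>j\<in>J. f j) powr q \<le> (real (card J) * x) powr q"
    using assms by (intro powr_mono2) (auto intro: sum_nonneg)
  also have "\<dots> = real (card J) powr q * f i powr q"
    using i assms by (simp add: powr_mult)
  also have "\<dots> \<le> real (card J) ^ m * (\<Sum>j\<in>J. f j powr q)"
  proof (intro mult_mono)
    have "1 \<le> card J" using assms(1) False by (simp add: Suc_leI card_gt_0_iff)
    then show "real (card J) powr q \<le> real (card J) ^ m"
      using assms by (subst powr_realpow[symmetric]) (auto intro: powr_mono)
    show "f i powr q \<le> (\<Sum>j\<in>J. f j powr q)"
      using i assms(1) by (intro member_le_sum) auto
  qed (auto intro: sum_nonneg)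
  finally show ?thesis .
qed simp

lemma convolve_process_finite:
  assumes "finite J" "\<And>j. j \<notin> J \<Longrightarrow> f (v - x j) = 0"
  shows "convolve_process f a x v = (\<Sum>j\<in>J. of_real (a j) * f (v - x j))"
  unfolding convolve_process_def using assms by (intro suminf_finite) auto

text \<open>A deterministic estimate for each realisation, whose constant is chosen before the
  scale, the frequencies, the configuration and \<open>t\<close>; this is the source of all later
  uniformity. With no point or one point both terms coincide, so the error vanishes. With more
  points the two nonnegative terms are bounded separately, and nothing is gained from their
  difference.\<close>

lemma scattering_single_point_approx:
  fixes w :: "'a::euclidean_space \<Rightarrow> complex"
  assumes w: "window w" and "0 < c" "1 \<le> p" "1 \<le> p'" "p * p' \<le> real m"
  obtains C where "0 \<le> C" "\<And>s \<xi> \<xi>' a x t. 0 < s \<Longrightarrow> finite {j. x j \<in> cbox (t - ((1 + c) * s) *\<^sub>R One) t} \<Longrightarrow>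
    \<bar>cmod (convolve (modpow p (convolve_process (gabor w (s, \<xi>)) a x)) (gabor w (c * s, \<xi>')) t) powr p'
      - s powr (real DIM('a) * p') * (\<Sum>j | x j \<in> cbox (t - ((1 + c) * s) *\<^sub>R One) t.
          \<bar>a j\<bar> powr (p * p') * cmod (profile w p c (s *\<^sub>R \<xi>') ((t - x j) /\<^sub>R s)) powr p')\<bar>
    \<le> C * s powr (real DIM('a) * p') *
       (if 2 \<le> card {j. x j \<in> cbox (t - ((1 + c) * s) *\<^sub>R One) t}
        then real (card {j. x j \<in> cbox (t - ((1 + c) * s) *\<^sub>R One) t}) ^ m *
          (\<Sum>j | x j \<in> cbox (t - ((1 + c) * s) *\<^sub>R One) t. \<bar>a j\<bar> powr (p * p')) else 0)"
proof -
  note [measurable] = window_measurable[OF w]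
  obtain D where D: "0 < D" "\<And>t. cmod (w t) \<le> D * indicator (cbox 0 One) t"
    using window_bounded[OF w] by blast
  \<comment> \<open>\<open>C1\<close> controls the true coefficient: D^p and D bound the two
    filters, and c^d is what remains of the volume (c s)^d of the second support once s^d is split
    off. \<open>C2\<close> controls the one-point values through the bound on the profile.\<close>
  define C1 where "C1 = (D * D powr p * c ^ DIM('a)) powr p'"
  define C2 where "C2 = (D * D powr p) powr p'"
  have C12: "0 \<le> C1" "0 \<le> C2" by (auto simp: C1_def C2_def)
  have q1: "1 \<le> p * p'"
    using assms mult_mono[of 1 p 1 p'] by simp
  show ?thesis
  proof (rule that[of "C1 + C2"])
    fix s :: real and \<xi> \<xi>' :: 'a and a :: "nat \<Rightarrow> real" and x :: "nat \<Rightarrow> 'a" and t :: 'a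
    assume s: "0 < s" and fin: "finite {j. x j \<in> cbox (t - ((1 + c) * s) *\<^sub>R One) t}"
    define J where "J = {j. x j \<in> cbox (t - ((1 + c) * s) *\<^sub>R One) t}"
    define G where "G = modpow p (convolve_process (gabor w (s, \<xi>)) a x)"
    define h where "h = gabor w (c * s, \<xi>')"
    define S where "S = (\<Sum>j\<in>J. \<bar>a j\<bar> powr (p * p'))"
    define \<phi> where "\<phi> j = cmod (profile w p c (s *\<^sub>R \<xi>') ((t - x j) /\<^sub>R s)) powr p'" for j
    define sp where "sp = s powr (real DIM('a) * p')"
    have sp: "sp = (s ^ DIM('a)) powr p'"
      using s by (simp add: sp_def powr_powr[symmetric] powr_realpow)
    have "finite J" using fin by (simp add: J_def)
    have cs: "0 < c * s" using s \<open>0 < c\<close> by simp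
    \<comment> \<open>If both filters are nonzero, then t - x_j = (t - u - x_j) + u lies in [0,s]^d
      + [0,c s]^d, which forces x_j into the box.\<close>
    have J0: "gabor w (s, \<xi>) (t - u - x j) = 0" if "h u \<noteq> 0" "j \<notin> J" for u j
    proof (rule ccontr)
      assume "gabor w (s, \<xi>) (t - u - x j) \<noteq> 0"
      then have 1: "t - u - x j \<in> cbox 0 (s *\<^sub>R One)"
        by (rule gabor_support[OF D(2) s])
      have 2: "u \<in> cbox 0 ((c * s) *\<^sub>R One)"
        using that(1) unfolding h_def by (rule gabor_support[OF D(2) cs])
      have "x j \<in> cbox (t - ((1 + c) * s) *\<^sub>R One) t"
        unfolding mem_box
      proof
        fix b :: 'a assume b: "b \<in> Basis"
        have "0 \<le> (t - u - x j) \<bullet> b" "(t - u - x j) \<bullet> b \<le> s" "0 \<le> u \<bullet> b" "u \<bullet> b \<le> c * s"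
          using 1 2 b by (auto simp: mem_box)
        then show "(t - ((1 + c) * s) *\<^sub>R One) \<bullet> b \<le> x j \<bullet> b \<and> x j \<bullet> b \<le> t \<bullet> b"
          using b by (simp add: inner_diff_left distrib_right)
      qed
      with that(2) show False by (simp add: J_def)
    qed
    have proc: "convolve_process (gabor w (s, \<xi>)) a x (t - u)
        = (\<Sum>j\<in>J. of_real (a j) * gabor w (s, \<xi>) (t - u - x j))" if "h u \<noteq> 0" for u
      by (rule convolve_process_finite[OF \<open>finite J\<close>]) (use J0 that in auto)
    have \<phi>_le: "\<phi> j \<le> C2" for j
      unfolding \<phi>_def C2_def using profile_le[OF D(2,1) \<open>0 < c\<close>, of p] D(1) assms
      by (intro powr_mono2) (auto intro: order_trans[OF profile_le[OF D(2,1) \<open>0 < c\<close>, of p]] simp: indicator_def)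
    have Z_le: "(\<Sum>j\<in>J. \<bar>a j\<bar> powr (p * p') * \<phi> j) \<le> C2 * S"
      unfolding S_def sum_distrib_left by (intro sum_mono) (metis \<phi>_le mult.commute mult_right_mono powr_ge_zero)
    have Z_ge: "0 \<le> (\<Sum>j\<in>J. \<bar>a j\<bar> powr (p * p') * \<phi> j)"
      by (intro sum_nonneg) (simp add: \<phi>_def)
    have S0: "0 \<le> S" by (simp add: S_def sum_nonneg)
    \<comment> \<open>The first layer is at most D times the sum of the \<bar>a_j\<bar>. After
      raising this to the power p, integrating against the second filter and raising to p', the sum
      appears with exponent q = p p', and \<open>sum_powr_le\<close> distributes that power over the
      points.\<close>
    have X_le: "cmod (convolve G h t) powr p' \<le> C1 * sp * (real (card J) ^ m * S)"
    proof -
      define E where "E = (D * (\<Sum>j\<in>J. \<bar>a j\<bar>)) powr p * D"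
      have E0: "0 \<le> E" using D(1) by (simp add: E_def)
      have bd: "cmod (G (t - u) * h u) \<le> E * indicator (cbox 0 ((c * s) *\<^sub>R One)) u" for u
      proof (cases "h u = 0")
        case False
        have hu: "cmod (h u) \<le> D * indicator (cbox 0 ((c * s) *\<^sub>R One)) u"
          unfolding h_def by (rule gabor_le[OF D(2) cs])
        have "cmod (convolve_process (gabor w (s, \<xi>)) a x (t - u)) \<le> (\<Sum>j\<in>J. cmod (of_real (a j) * gabor w (s, \<xi>) (t - u - x j)))"
          unfolding proc[OF False] by (rule norm_sum)
        also have "\<dots> \<le> (\<Sum>j\<in>J. D * \<bar>a j\<bar>)"
        proof (rule sum_mono)
          fix j
          have "cmod (gabor w (s, \<xi>) (t - u - x j)) \<le> D"
            using gabor_le[OF D(2) s, of \<xi> "t - u - x j"] D(1)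
            by (cases "t - u - x j \<in> cbox 0 (s *\<^sub>R One)") auto
          then show "cmod (of_real (a j) * gabor w (s, \<xi>) (t - u - x j)) \<le> D * \<bar>a j\<bar>"
            by (simp add: norm_mult mult.commute[of D] mult_left_mono)
        qed
        finally have "cmod (G (t - u)) \<le> (D * (\<Sum>j\<in>J. \<bar>a j\<bar>)) powr p"
          unfolding G_def modpow_def using assms by (auto simp: sum_distrib_left intro!: powr_mono2)
        then have "cmod (G (t - u)) * cmod (h u) \<le> (D * (\<Sum>j\<in>J. \<bar>a j\<bar>)) powr p * (D * indicator (cbox 0 ((c * s) *\<^sub>R One)) u)"
          using hu by (intro mult_mono) auto
        then show ?thesis by (simp add: norm_mult E_def mult.assoc)
      qed (use E0 in auto)
      have "cmod (convolve G h t) \<le> E * measure lborel (cbox 0 ((c * s) *\<^sub>R One :: 'a))"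
        unfolding convolve_def by (rule norm_integral_le_indicator[OF _ _ E0 bd]) (use emeasure_lborel_cbox_finite in auto)
      also have "\<dots> = E * (c * s) ^ DIM('a)"
        using content_cbox_scaleR_One[of "c * s" "0::'a"] cs by simp
      also have "\<dots> = (D * D powr p * c ^ DIM('a)) * s ^ DIM('a) * (\<Sum>j\<in>J. \<bar>a j\<bar>) powr p"
        using D(1) by (simp add: E_def powr_mult sum_nonneg power_mult_distrib)
      finally have "cmod (convolve G h t) powr p' \<le> ((D * D powr p * c ^ DIM('a)) * s ^ DIM('a) * (\<Sum>j\<in>J. \<bar>a j\<bar>) powr p) powr p'"
        using assms by (intro powr_mono2) auto
      also have "\<dots> = C1 * sp * (\<Sum>j\<in>J. \<bar>a j\<bar>) powr (p * p')"
        using D(1) s \<open>0 < c\<close> by (simp add: C1_def sp powr_mult powr_powr)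
      also have "\<dots> \<le> C1 * sp * (real (card J) ^ m * S)"
        unfolding S_def using C12 assms q1 \<open>finite J\<close>
        by (intro mult_left_mono sum_powr_le) (auto simp: sp_def)
      finally show ?thesis .
    qed
    have "\<bar>cmod (convolve G h t) powr p' - sp * (\<Sum>j\<in>J. \<bar>a j\<bar> powr (p * p') * \<phi> j)\<bar>
      \<le> (C1 + C2) * sp * (if 2 \<le> card J then real (card J) ^ m * S else 0)"
    proof -
      consider "2 \<le> card J" | "card J = 0" | "card J = 1" by linarith
      then show ?thesis
      proof cases
        case 1
        have "1 \<le> real (card J) ^ m" using 1 by simp
        then have S1: "S \<le> real (card J) ^ m * S"
          using S0 by (simp add: mult_le_cancel_right1)
        have "sp * (\<Sum>j\<in>J. \<bar>a j\<bar> powr (p * p') * \<phi> j) \<le> sp * (C2 * (real (card J) ^ m * S))"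
          using Z_le S1 C12 by (intro mult_left_mono) (auto intro: order_trans mult_left_mono simp: sp_def)
        moreover have "0 \<le> sp * (\<Sum>j\<in>J. \<bar>a j\<bar> powr (p * p') * \<phi> j)"
          using Z_ge by (simp add: sp_def)
        moreover have "0 \<le> cmod (convolve G h t) powr p'" by simp
        moreover have "0 \<le> C1 * sp * (real (card J) ^ m * S)" "0 \<le> sp * (C2 * (real (card J) ^ m * S))"
          using S0 C12 by (auto simp: sp_def)
        moreover have "(C1 + C2) * sp * (real (card J) ^ m * S) = C1 * sp * (real (card J) ^ m * S) + sp * (C2 * (real (card J) ^ m * S))"
          by (simp add: algebra_simps)
        ultimately show ?thesis
          using X_le 1 by (simp only: if_True abs_le_iff) linarith
      next
        case 2
        then have "J = {}" using \<open>finite J\<close> by simp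
        have "G (t - u) * h u = 0" for u
          using proc[of u] \<open>J = {}\<close> by (cases "h u = 0") (auto simp: G_def modpow_def)
        then have "convolve G h t = 0" 
          unfolding convolve_def by (simp only: Bochner_Integration.integral_zero)
        then show ?thesis using \<open>J = {}\<close> by simp
      next
        case 3
        then obtain i where i: "J = {i}" by (auto simp: card_1_singleton_iff)
        have "G (t - u) * h u = modpow p (\<lambda>v. of_real (a i) * gabor w (s, \<xi>) (v - x i)) (t - u) * h u" for u
          using proc[of u] i by (cases "h u = 0") (auto simp: G_def modpow_def)
        then have "convolve G h t = convolve (modpow p (\<lambda>v. of_real (a i) * gabor w (s, \<xi>) (v - x i))) h t"
          unfolding convolve_def by (simp only:)
        also have "\<dots> = of_real (\<bar>a i\<bar> powr p * s ^ DIM('a)) * profile w p c (s *\<^sub>R \<xi>') ((t - x i) /\<^sub>R s)"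
          unfolding h_def by (rule convolve_single_point) (use s \<open>0 < c\<close> in auto)
        finally have "cmod (convolve G h t) powr p' = sp * (\<bar>a i\<bar> powr (p * p') * \<phi> i)"
          using s by (simp add: norm_mult powr_mult powr_powr sp \<phi>_def norm_power)
        then show ?thesis using i by simp
      qed
    qed
    then show "\<bar>cmod (convolve (modpow p (convolve_process (gabor w (s, \<xi>)) a x)) (gabor w (c * s, \<xi>')) t) powr p'
      - s powr (real DIM('a) * p') * (\<Sum>j | x j \<in> cbox (t - ((1 + c) * s) *\<^sub>R One) t.
          \<bar>a j\<bar> powr (p * p') * cmod (profile w p c (s *\<^sub>R \<xi>') ((t - x j) /\<^sub>R s)) powr p')\<bar>
    \<le> (C1 + C2) * s powr (real DIM('a) * p') *
       (if 2 \<le> card {j. x j \<in> cbox (t - ((1 + c) * s) *\<^sub>R One) t}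
        then real (card {j. x j \<in> cbox (t - ((1 + c) * s) *\<^sub>R One) t}) ^ m *
          (\<Sum>j | x j \<in> cbox (t - ((1 + c) * s) *\<^sub>R One) t. \<bar>a j\<bar> powr (p * p')) else 0)"
      unfolding G_def h_def S_def \<phi>_def sp_def J_def .
  qed (use C12 in simp)
qed

section \<open>Moments and Campbell's formula for marked Poisson points\<close>

lemma power_le_fact_mult_exp:
  fixes x :: real
  assumes "0 \<le> x"
  shows "x ^ k \<le> fact k * exp x"
proof -
  have "x ^ k /\<^sub>R fact k \<le> (\<Sum>n. x ^ n /\<^sub>R fact n)"
    using sum_le_suminf[OF summable_exp_generic[of x], of "{k}"] assms by simp
  then show ?thesis
    by (simp add: exp_def field_simps)
qed

text \<open>For n >= 2 one can split off r^2 from r^n and bound the rest r^(n-2) by R^n, which uses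
  R >= 1. With n^k <= k! e^n the remaining series is that of exp (e R). The constant serves all r <=
  R at once.\<close>

lemma poisson_tail_moment_le:
  fixes r R :: real
  assumes "0 \<le> r" "r \<le> R" "1 \<le> R"
  shows "(\<Sum>n. (if 2 \<le> n then ennreal (real n ^ k) else 0) * ennreal (exp (- r) * r ^ n / fact n))
    \<le> ennreal (fact k * exp (exp 1 * R) * r\<^sup>2)"
proof -
  have le: "(if 2 \<le> n then ennreal (real n ^ k) else 0) * ennreal (exp (- r) * r ^ n / fact n)
      \<le> ennreal (fact k * r\<^sup>2 * ((exp 1 * R) ^ n /\<^sub>R fact n))" for n
  proof (cases "2 \<le> n")
    case True
    have 1: "real n ^ k \<le> fact k * exp 1 ^ n"
      using power_le_fact_mult_exp[of "real n" k] by (simp add: exp_of_nat_mult[symmetric])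
    have "r ^ n = r\<^sup>2 * r ^ (n - 2)"
      using True by (metis le_add_diff_inverse power_add)
    also have "\<dots> \<le> r\<^sup>2 * R ^ n"
      using assms by (intro mult_left_mono order_trans[OF power_mono power_increasing]) auto
    finally have "exp (- r) * r ^ n \<le> 1 * (r\<^sup>2 * R ^ n)"
      using assms by (intro mult_mono) auto
    then have "real n ^ k * (exp (- r) * r ^ n) \<le> (fact k * exp 1 ^ n) * (1 * (r\<^sup>2 * R ^ n))"
      by (rule mult_mono[OF 1]) (use assms in auto)
    then have "real n ^ k * (exp (- r) * r ^ n / fact n) \<le> fact k * r\<^sup>2 * ((exp 1 * R) ^ n /\<^sub>R fact n)"
      by (simp add: field_simps power_mult_distrib)
    then show ?thesis
      using True assms by (simp add: ennreal_mult[symmetric] ennreal_leI)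
  qed simp
  have sums: "(\<lambda>n. fact k * r\<^sup>2 * ((exp 1 * R) ^ n /\<^sub>R fact n)) sums (fact k * r\<^sup>2 * exp (exp 1 * R))"
    by (intro sums_mult exp_converges)
  have "(\<Sum>n. (if 2 \<le> n then ennreal (real n ^ k) else 0) * ennreal (exp (- r) * r ^ n / fact n))
      \<le> (\<Sum>n. ennreal (fact k * r\<^sup>2 * ((exp 1 * R) ^ n /\<^sub>R fact n)))"
    by (intro suminf_le le) auto
  also have "\<dots> = ennreal (fact k * r\<^sup>2 * exp (exp 1 * R))"
    using assms sums by (subst suminf_ennreal2) (auto simp: sums_iff)
  finally show ?thesis by (simp add: mult_ac)
qed

section \<open>Counting functionals of a point configuration and the Poisson law\<close>

lemma emeasure_dirac_sum:
  assumes "B \<in> sets borel"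
  shows "emeasure (dirac_sum x) B = (\<Sum>j. indicator B (x j))"
proof -
  have "emeasure (dirac_sum x) B = emeasure (count_space UNIV) (x -` B)"
    using assms by (simp add: dirac_sum_def emeasure_distr)
  also have "\<dots> = (\<integral>\<^sup>+j. indicator (x -` B) j \<partial>count_space UNIV)"
    by simp
  also have "\<dots> = (\<Sum>j. indicator B (x j))"
    by (simp add: nn_integral_count_space_nat indicator_def)
  finally show ?thesis .
qed

lemma emeasure_dirac_sum_eq_of_nat_iff:
  assumes "B \<in> sets borel"
  shows "emeasure (dirac_sum x) B = of_nat n \<longleftrightarrow> finite {j. x j \<in> B} \<and> card {j. x j \<in> B} = n"
  using assms by (auto simp: dirac_sum_def emeasure_distr emeasure_count_space vimage_def)

text \<open>Realisations with infinitely many points in B get the value 0.\<close>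

definition count_fun :: "'a::euclidean_space set \<Rightarrow> (nat \<Rightarrow> ennreal) \<Rightarrow> (nat \<Rightarrow> 'a) \<Rightarrow> ennreal" where
  "count_fun B h x = (\<Sum>n. h n * indicator {x. emeasure (dirac_sum x) B = of_nat n} x)"

lemma count_fun_eq:
  assumes "B \<in> sets borel"
  shows "count_fun B h x = (if finite {j. x j \<in> B} then h (card {j. x j \<in> B}) else 0)"
proof (cases "finite {j. x j \<in> B}")
  case True
  have "count_fun B h x = (\<Sum>n\<in>{card {j. x j \<in> B}}. h n * indicator {x. emeasure (dirac_sum x) B = of_nat n} x)"
    unfolding count_fun_def
    by (rule suminf_finite) (use True emeasure_dirac_sum_eq_of_nat_iff[OF assms, of x] in auto)
  also have "\<dots> = h (card {j. x j \<in> B})"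
    using True emeasure_dirac_sum_eq_of_nat_iff[OF assms, of x] by simp
  finally show ?thesis using True by simp
next
  case False
  then show ?thesis
    using emeasure_dirac_sum_eq_of_nat_iff[OF assms, of x] by (simp add: count_fun_def)
qed

lemma count_fun_measurable [measurable]:
  fixes B :: "'a::euclidean_space set"
  assumes [measurable]: "B \<in> sets borel"
  shows "count_fun B h \<in> borel_measurable (Pi\<^sub>M UNIV (\<lambda>_. borel))"
proof -
  have [measurable]: "{x. (\<Sum>j. indicator B (x j)) = (of_nat n :: ennreal)} \<in> sets (Pi\<^sub>M UNIV (\<lambda>_::nat. borel))" for n
  proof -
    have "{x \<in> space (Pi\<^sub>M UNIV (\<lambda>_::nat. borel :: 'a measure)). (\<Sum>j. indicator B (x j)) = (of_nat n :: ennreal)}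
        \<in> sets (Pi\<^sub>M UNIV (\<lambda>_::nat. borel))"
      by measurable
    then show ?thesis by (simp add: space_PiM)
  qed
  show ?thesis
    unfolding count_fun_def[abs_def] emeasure_dirac_sum[OF assms] by measurable
qed

context poisson_point_process
begin

lemma points_measurable [measurable]: "(\<lambda>\<omega> j. pt j \<omega>) \<in> measurable M (Pi\<^sub>M UNIV (\<lambda>_. borel))"
  using random_points by (intro measurable_PiM_single') auto

text \<open>\<open>count_fun\<close> is a series of indicators of the events N(B) = n, so its
  expectation is computed termwise and \<open>poisson_counts\<close> supplies the weights. All uses
  of the Poisson distribution pass through this formula.\<close>

lemma nn_integral_count_fun:
  fixes B :: "'a set"
  assumes B [measurable]: "B \<in> sets borel"
  shows "(\<integral>\<^sup>+\<omega>. count_fun B h (\<lambda>j. pt j \<omega>) \<partial>M)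
    = (\<Sum>n. h n * ennreal (if emeasure (intensity_measure lam) B = \<infinity> then 0
            else exp (- measure (intensity_measure lam) B) * measure (intensity_measure lam) B ^ n / fact n))"
proof -
  note [measurable] = random_points
  have [measurable]: "{\<omega> \<in> space M. emeasure (dirac_sum (\<lambda>j. pt j \<omega>)) B = of_nat n} \<in> events" for n
    unfolding emeasure_dirac_sum[OF B] by measurable
  have "(\<integral>\<^sup>+\<omega>. count_fun B h (\<lambda>j. pt j \<omega>) \<partial>M)
      = (\<integral>\<^sup>+\<omega>. (\<Sum>n. h n * indicator {\<omega> \<in> space M. emeasure (dirac_sum (\<lambda>j. pt j \<omega>)) B = of_nat n} \<omega>) \<partial>M)"
    unfolding count_fun_def by (intro nn_integral_cong suminf_cong) (simp add: indicator_def)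
  also have "\<dots> = (\<Sum>n. h n * emeasure M {\<omega> \<in> space M. emeasure (dirac_sum (\<lambda>j. pt j \<omega>)) B = of_nat n})"
    by (subst nn_integral_suminf) (auto simp: nn_integral_cmult_indicator)
  also have "\<dots> = (\<Sum>n. h n * ennreal (if emeasure (intensity_measure lam) B = \<infinity> then 0
            else exp (- measure (intensity_measure lam) B) * measure (intensity_measure lam) B ^ n / fact n))"
    unfolding emeasure_eq_measure poisson_counts[OF B] ..
  finally show ?thesis .
qed

text \<open>With \<open>h\<close> constantly 1, \<open>count_fun\<close> is the indicator of
  finiteness, and the Poisson weights sum to 1. For infinite intensity every weight is 0, so N(B) is
  almost surely infinite.\<close>

lemma prob_finite_count:
  assumes B: "B \<in> sets borel"
  shows "emeasure M {\<omega> \<in> space M. finite {j. pt j \<omega> \<in> B}} = (if emeasure (intensity_measure lam) B = \<infinity> then 0 else 1)"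
    and "{\<omega> \<in> space M. finite {j. pt j \<omega> \<in> B}} \<in> events"
proof -
  define F where "F = {\<omega> \<in> space M. finite {j. pt j \<omega> \<in> B}}"
  have F: "count_fun B (\<lambda>_. 1) (\<lambda>j. pt j \<omega>) = indicator F \<omega>" if "\<omega> \<in> space M" for \<omega>
    using that by (simp add: count_fun_eq[OF B] F_def)
  have "(\<lambda>\<omega>. count_fun B (\<lambda>_. 1) (\<lambda>j. pt j \<omega>)) \<in> borel_measurable M"
    using B by measurable
  then have "(\<lambda>\<omega>. indicator F \<omega> :: ennreal) \<in> borel_measurable M"
    by (subst (asm) measurable_cong[OF F]) auto
  then have "F \<inter> space M \<in> events"
    by (simp add: borel_measurable_indicator_iff)
  then show Fm: "{\<omega> \<in> space M. finite {j. pt j \<omega> \<in> B}} \<in> events"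
    by (simp add: F_def Int_def conj_commute cong: conj_cong)
  have "emeasure M F = (\<integral>\<^sup>+\<omega>. count_fun B (\<lambda>_. 1) (\<lambda>j. pt j \<omega>) \<partial>M)"
    using Fm by (subst nn_integral_cong[OF F]) (auto simp: F_def)
  also have "\<dots> = (if emeasure (intensity_measure lam) B = \<infinity> then 0 else 1)"
  proof (cases "emeasure (intensity_measure lam) B = \<infinity>")
    case False
    let ?r = "measure (intensity_measure lam) B"
    have "(\<lambda>n. exp (- ?r) * (?r ^ n /\<^sub>R fact n)) sums (exp (- ?r) * exp ?r)"
      by (intro sums_mult exp_converges)
    then have "(\<lambda>n. exp (- ?r) * ?r ^ n / fact n) sums 1"
      by (simp add: exp_minus divide_inverse mult_ac)
    then show ?thesis
      using False by (simp add: nn_integral_count_fun[OF B] suminf_ennreal2 sums_iff)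
  qed (simp add: nn_integral_count_fun[OF B])
  finally show "emeasure M {\<omega> \<in> space M. finite {j. pt j \<omega> \<in> B}} = (if emeasure (intensity_measure lam) B = \<infinity> then 0 else 1)"
    by (simp add: F_def)
qed

lemma AE_finite_count:
  assumes "B \<in> sets borel" "emeasure (intensity_measure lam) B \<noteq> \<infinity>"
  shows "AE \<omega> in M. finite {j. pt j \<omega> \<in> B}"
  using prob_finite_count[OF assms(1)] assms(2)
  by (intro AE_I_eq_1) auto

lemma nn_integral_count:
  assumes B [measurable]: "B \<in> sets borel"
  shows "(\<integral>\<^sup>+\<omega>. emeasure (dirac_sum (\<lambda>j. pt j \<omega>)) B \<partial>M) = emeasure (intensity_measure lam) B"
proof (cases "emeasure (intensity_measure lam) B = \<infinity>")
  case True
  have "AE \<omega> in M. \<not> finite {j. pt j \<omega> \<in> B}"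
    by (rule AE_I[OF _ _ prob_finite_count(2)[OF B]]) (use prob_finite_count(1)[OF B] True in auto)
  then have "(\<integral>\<^sup>+\<omega>. emeasure (dirac_sum (\<lambda>j. pt j \<omega>)) B \<partial>M) = (\<integral>\<^sup>+\<omega>. \<infinity> \<partial>M)"
    using B by (intro nn_integral_cong_AE) (auto simp: dirac_sum_def emeasure_distr emeasure_count_space vimage_def)
  then show ?thesis using True by (simp add: emeasure_space_1)
next
  case False
  let ?r = "measure (intensity_measure lam) B"
  have "AE \<omega> in M. finite {j. pt j \<omega> \<in> B}" by (rule AE_finite_count[OF B False])
  then have "(\<integral>\<^sup>+\<omega>. emeasure (dirac_sum (\<lambda>j. pt j \<omega>)) B \<partial>M) = (\<integral>\<^sup>+\<omega>. count_fun B of_nat (\<lambda>j. pt j \<omega>) \<partial>M)"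
    using B by (intro nn_integral_cong_AE)
      (auto simp: count_fun_eq dirac_sum_def emeasure_distr emeasure_count_space vimage_def)
  also have "\<dots> = (\<Sum>n. ennreal (real n * (exp (- ?r) * ?r ^ n / fact n)))"
    unfolding nn_integral_count_fun[OF B]
    using False by (intro suminf_cong) (simp add: ennreal_of_nat_eq_real_of_nat ennreal_mult[symmetric])
  also have "\<dots> = ennreal ?r"
  proof -
    \<comment> \<open>The mean series has zero term at n = 0, so it is evaluated from n = 1: n r^n /
      n! is r times the exponential term of index n - 1.\<close>
    have "(\<lambda>n. (?r * exp (- ?r)) * (?r ^ n /\<^sub>R fact n)) sums ((?r * exp (- ?r)) * exp ?r)"
      by (intro sums_mult exp_converges)
    then have "(\<lambda>n. real (Suc n) * (exp (- ?r) * ?r ^ Suc n / fact (Suc n))) sums ?r"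
      by (simp add: exp_minus field_simps del: of_nat_Suc)
    then have "(\<lambda>n. real n * (exp (- ?r) * ?r ^ n / fact n)) sums ?r"
      by (subst (asm) sums_Suc_iff) simp
    then show ?thesis by (subst suminf_ennreal2) (auto simp: sums_iff)
  qed
  also have "\<dots> = emeasure (intensity_measure lam) B"
    using False by (simp add: emeasure_eq_ennreal_measure)
  finally show ?thesis .
qed

text \<open>The image of counting measure times \<open>M\<close> under (j, \<omega>) ->
  \<open>pt j \<omega>\<close> is the mean measure of the process. By
  \<open>nn_integral_count\<close> it agrees with the intensity measure on every Borel set, infinite
  values included, so the two measures are equal and the integral of any \<open>f\<close> transfers
  at once.\<close>

lemma campbell:
  assumes [measurable]: "f \<in> borel_measurable borel"
  shows "(\<Sum>j. \<integral>\<^sup>+\<omega>. f (pt j \<omega>) \<partial>M) = (\<integral>\<^sup>+x. f x \<partial>intensity_measure lam)"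
proof -
  note [measurable] = random_points
  let ?P = "count_space (UNIV::nat set) \<Otimes>\<^sub>M M"
  have m [measurable]: "(\<lambda>(j, \<omega>). pt j \<omega>) \<in> measurable ?P borel"
    by (rule measurable_pair_measure_countable1) auto
  have sum: "(\<integral>\<^sup>+z. g (case z of (j, \<omega>) \<Rightarrow> pt j \<omega>) \<partial>?P) = (\<Sum>j. \<integral>\<^sup>+\<omega>. g (pt j \<omega>) \<partial>M)"
    if [measurable]: "g \<in> borel_measurable borel" for g :: "'a \<Rightarrow> ennreal"
    by (subst nn_integral_fst[symmetric]) (auto simp: nn_integral_count_space_nat)
  have "distr ?P borel (\<lambda>(j, \<omega>). pt j \<omega>) = intensity_measure lam"
  proof (rule measure_eqI)
    fix B assume "B \<in> sets (distr ?P borel (\<lambda>(j, \<omega>). pt j \<omega>))"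
    then have B [measurable]: "B \<in> sets borel" by simp
    have "emeasure (distr ?P borel (\<lambda>(j, \<omega>). pt j \<omega>)) B
        = (\<integral>\<^sup>+x. indicator B x \<partial>distr ?P borel (\<lambda>(j, \<omega>). pt j \<omega>))"
      by simp
    also have "\<dots> = (\<Sum>j. \<integral>\<^sup>+\<omega>. indicator B (pt j \<omega>) \<partial>M)"
      by (subst nn_integral_distr) (auto intro: sum)
    also have "\<dots> = (\<integral>\<^sup>+\<omega>. emeasure (dirac_sum (\<lambda>j. pt j \<omega>)) B \<partial>M)"
      unfolding emeasure_dirac_sum[OF B] by (subst nn_integral_suminf) auto
    finally show "emeasure (distr ?P borel (\<lambda>(j, \<omega>). pt j \<omega>)) B = emeasure (intensity_measure lam) B"
      by (simp add: nn_integral_count[OF B])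
  qed (simp add: intensity_measure_def)
  then have "(\<integral>\<^sup>+x. f x \<partial>intensity_measure lam) = (\<integral>\<^sup>+x. f x \<partial>distr ?P borel (\<lambda>(j, \<omega>). pt j \<omega>))"
    by simp
  also have "\<dots> = (\<Sum>j. \<integral>\<^sup>+\<omega>. f (pt j \<omega>) \<partial>M)"
    by (subst nn_integral_distr) (auto intro: sum)
  finally show ?thesis by simp
qed

end

section \<open>Separating charges from points\<close>

context compound_poisson_process
begin

lemma charge_measurable [measurable]: "random_variable borel (A j)"
  using indep_charges by (simp add: indep_vars_def2)

lemma charges_measurable [measurable]: "(\<lambda>\<omega> j. A j \<omega>) \<in> measurable M (Pi\<^sub>M UNIV (\<lambda>_. borel))"
  by (intro measurable_PiM_single') auto

text \<open>Charge and point sequences have different types, but after applying \<open>f\<close> and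
  \<open>g\<close> both variables take values in \<open>ennreal\<close>. Independence of the
  generated sigma-algebras then passes to ordinary independence of random variables, for which
  expectations of products factor.\<close>

lemma nn_integral_charges_points_mult:
  assumes [measurable]: "f \<in> borel_measurable (Pi\<^sub>M UNIV (\<lambda>_. borel))" "g \<in> borel_measurable (Pi\<^sub>M UNIV (\<lambda>_. borel))"
  shows "(\<integral>\<^sup>+\<omega>. f (\<lambda>j. A j \<omega>) * g (\<lambda>j. pt j \<omega>) \<partial>M)
    = (\<integral>\<^sup>+\<omega>. f (\<lambda>j. A j \<omega>) \<partial>M) * (\<integral>\<^sup>+\<omega>. g (\<lambda>j. pt j \<omega>) \<partial>M)"
proof -
  \<comment> \<open>A measurable function of X generates no more events than X itself, since each
    preimage under h o X is the X-preimage of a measurable set.\<close>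
  have sub: "sigma_sets (space M) {(\<lambda>\<omega>. h (X \<omega>)) -` S \<inter> space M |S. S \<in> sets borel}
      \<subseteq> sets (vimage_algebra (space M) X N)"
    if h: "h \<in> borel_measurable N" and X: "X \<in> measurable M N" for h :: "'b \<Rightarrow> ennreal" and X N
  proof -
    have Xs: "X \<in> space M \<rightarrow> space N" using X by (rule measurable_space[THEN Pi_I])
    have "{(\<lambda>\<omega>. h (X \<omega>)) -` S \<inter> space M |S. S \<in> sets borel} \<subseteq> sets (vimage_algebra (space M) X N)"
    proof safe
      fix S :: "ennreal set" assume "S \<in> sets borel"
      then have "h -` S \<inter> space N \<in> sets N" using h by (rule measurable_sets[rotated])
      moreover have "(\<lambda>\<omega>. h (X \<omega>)) -` S \<inter> space M = X -` (h -` S \<inter> space N) \<inter> space M"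
        using Xs by auto
      ultimately show "(\<lambda>\<omega>. h (X \<omega>)) -` S \<inter> space M \<in> sets (vimage_algebra (space M) X N)"
        by (simp only: in_vimage_algebra)
    qed
    then have "sigma_sets (space (vimage_algebra (space M) X N)) {(\<lambda>\<omega>. h (X \<omega>)) -` S \<inter> space M |S. S \<in> sets borel}
      \<subseteq> sets (vimage_algebra (space M) X N)"
      by (rule sets.sigma_sets_subset)
    then show ?thesis by simp
  qed
  have "indep_var borel (\<lambda>\<omega>. f (\<lambda>j. A j \<omega>)) borel (\<lambda>\<omega>. g (\<lambda>j. pt j \<omega>))"
    unfolding indep_var_eq
  proof (intro conjI)
    show "indep_set (sigma_sets (space M) {(\<lambda>\<omega>. f (\<lambda>j. A j \<omega>)) -` S \<inter> space M |S. S \<in> sets borel})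
      (sigma_sets (space M) {(\<lambda>\<omega>. g (\<lambda>j. pt j \<omega>)) -` S \<inter> space M |S. S \<in> sets borel})"
      unfolding indep_set_def
      by (rule indep_sets_mono_sets[OF charges_indep_points[unfolded indep_set_def]])
        (use sub[OF assms(1) charges_measurable] sub[OF assms(2) points_measurable] in \<open>auto split: bool.split\<close>)
  qed measurable
  then have "indep_vars (case_bool borel borel) (case_bool (\<lambda>\<omega>. f (\<lambda>j. A j \<omega>)) (\<lambda>\<omega>. g (\<lambda>j. pt j \<omega>))) UNIV"
    by (simp add: indep_var_def)
  also have "case_bool borel borel = (\<lambda>_::bool. borel :: ennreal measure)"
    by (auto split: bool.split)
  finally have "(\<integral>\<^sup>+\<omega>. (\<Prod>b\<in>UNIV. case_bool (\<lambda>\<omega>. f (\<lambda>j. A j \<omega>)) (\<lambda>\<omega>. g (\<lambda>j. pt j \<omega>)) b \<omega>) \<partial>M)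
    = (\<Prod>b\<in>UNIV. \<integral>\<^sup>+\<omega>. case_bool (\<lambda>\<omega>. f (\<lambda>j. A j \<omega>)) (\<lambda>\<omega>. g (\<lambda>j. pt j \<omega>)) b \<omega> \<partial>M)"
    by (intro indep_vars_nn_integral) auto
  then show ?thesis by (simp add: UNIV_bool mult.commute)
qed

text \<open>Each weight \<open>g j\<close> may depend on the whole configuration. The error term
  needs this generality, because there the charge of a point in B is multiplied by a power of the
  total count N(B).\<close>

lemma nn_integral_marked_sum:
  assumes [measurable]: "h \<in> borel_measurable borel" "\<And>j. g j \<in> borel_measurable (Pi\<^sub>M UNIV (\<lambda>_. borel))"
  shows "(\<integral>\<^sup>+\<omega>. (\<Sum>j. h (A j \<omega>) * g j (\<lambda>j. pt j \<omega>)) \<partial>M)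
    = (\<integral>\<^sup>+\<omega>. h (A 0 \<omega>) \<partial>M) * (\<integral>\<^sup>+\<omega>. (\<Sum>j. g j (\<lambda>j. pt j \<omega>)) \<partial>M)"
proof -
  have hA: "(\<integral>\<^sup>+\<omega>. h (A j \<omega>) \<partial>M) = (\<integral>\<^sup>+\<omega>. h (A 0 \<omega>) \<partial>M)" for j
    using nn_integral_distr[of "A j" M borel h] nn_integral_distr[of "A 0" M borel h] identically_distributed[of j]
    by simp
  have "(\<integral>\<^sup>+\<omega>. (\<Sum>j. h (A j \<omega>) * g j (\<lambda>j. pt j \<omega>)) \<partial>M)
      = (\<Sum>j. \<integral>\<^sup>+\<omega>. h (A j \<omega>) * g j (\<lambda>j. pt j \<omega>) \<partial>M)"
    by (rule nn_integral_suminf) measurable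
  also have "\<dots> = (\<Sum>j. (\<integral>\<^sup>+\<omega>. h (A 0 \<omega>) \<partial>M) * (\<integral>\<^sup>+\<omega>. g j (\<lambda>j. pt j \<omega>) \<partial>M))"
    by (intro suminf_cong, subst hA[symmetric], rule nn_integral_charges_points_mult) measurable
  also have "\<dots> = (\<integral>\<^sup>+\<omega>. h (A 0 \<omega>) \<partial>M) * (\<integral>\<^sup>+\<omega>. (\<Sum>j. g j (\<lambda>j. pt j \<omega>)) \<partial>M)"
    by (subst nn_integral_suminf) auto
  finally show ?thesis .
qed

end

section \<open>Small-scale asymptotics\<close>

lemma intensity_measure_box_le:
  fixes lam :: "'a::euclidean_space \<Rightarrow> real"
  assumes [measurable]: "lam \<in> borel_measurable borel" and lam: "\<And>x. 0 \<le> lam x" "\<And>x. lam x \<le> l" and "0 \<le> r"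
  shows "emeasure (intensity_measure lam) (cbox (t - r *\<^sub>R One) t) \<le> ennreal (l * r ^ DIM('a))"
proof -
  have l: "0 \<le> l" using lam[of 0] by linarith
  have "emeasure (intensity_measure lam) (cbox (t - r *\<^sub>R One) t)
      = (\<integral>\<^sup>+x. ennreal (lam x) * indicator (cbox (t - r *\<^sub>R One) t) x \<partial>lborel)"
    unfolding intensity_measure_def by (subst emeasure_density) auto
  also have "\<dots> \<le> (\<integral>\<^sup>+x. ennreal l * indicator (cbox (t - r *\<^sub>R One) t) x \<partial>lborel)"
    using lam by (intro nn_integral_mono mult_right_mono ennreal_leI) auto
  also have "\<dots> = ennreal l * emeasure lborel (cbox (t - r *\<^sub>R One) t)"
    by (rule nn_integral_cmult_indicator) auto
  also have "emeasure lborel (cbox (t - r *\<^sub>R One) t) = ennreal (measure lborel (cbox (t - r *\<^sub>R One) t))"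
    by (rule emeasure_eq_ennreal_measure) (use emeasure_lborel_cbox_finite in \<open>auto simp: less_top\<close>)
  also have "measure lborel (cbox (t - r *\<^sub>R One) t) = r ^ DIM('a)"
    using content_cbox_scaleR_One[OF \<open>0 \<le> r\<close>, of "t - r *\<^sub>R One"] by simp
  finally show ?thesis using l \<open>0 \<le> r\<close> by (simp add: ennreal_mult)
qed

lemma integrable_cbox_bound:
  fixes f :: "'a::euclidean_space \<Rightarrow> real"
  assumes "f \<in> borel_measurable borel" "\<And>x. \<bar>f x\<bar> \<le> C * indicator (cbox a b) x"
  shows "integrable lborel f"
proof (rule Bochner_Integration.integrable_bound)
  show "integrable lborel (\<lambda>x. C * indicator (cbox a b) x)"
    by (intro integrable_mult_right integrable_real_indicator) (use emeasure_lborel_cbox_finite in auto)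
  show "AE x in lborel. norm (f x) \<le> norm (C * indicator (cbox a b) x)"
    unfolding real_norm_def by (intro AE_I2 order_trans[OF assms(2) abs_ge_self])
qed (use assms in simp)

section \<open>Measurability of the moments and their first-order expansion\<close>

context compound_poisson_process
begin

text \<open>Joint measurability in time and \<omega> makes the expectation a measurable function of
  \<open>t\<close>, as needed for averaging over the period cube.\<close>

lemma scattering_integrand_measurable:
  assumes [measurable]: "w \<in> borel_measurable borel"
  shows "(\<lambda>(t, \<omega>). cmod (convolve
               (modpow p (convolve_process (gabor w \<gamma>) (\<lambda>j. A j \<omega>) (\<lambda>j. pt j \<omega>)))
               (gabor w \<gamma>') t) powr p') \<in> borel_measurable (borel \<Otimes>\<^sub>M M)"
proof -
  note [measurable] = random_points
  show ?thesis
    unfolding convolve_def modpow_def convolve_process_def by measurable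
qed

lemma scattering_moment_measurable:
  assumes [measurable]: "w \<in> borel_measurable borel"
  shows "scattering_moment M pt A w \<gamma> p \<gamma>' p' \<in> borel_measurable borel"
proof -
  note [measurable] = scattering_integrand_measurable[OF assms]
  show ?thesis unfolding scattering_moment_def[abs_def] by measurable
qed

text \<open>The probabilistic content of the theorem as one inequality with a deterministic main
  term. Being uniform in \<open>t\<close>, in the frequencies and in s <= \<open>smax\<close>, it
  yields both the pointwise limit and the bound that dominates the average over the cube.\<close>

lemma scattering_moment_approx:
  assumes w: "window w" and lam_m [measurable]: "lam \<in> borel_measurable borel"
    and lam: "\<And>x. 0 \<le> lam x" "\<And>x. lam x \<le> l"
    and "0 < c" "1 \<le> p" "1 \<le> p'"
    and int: "integrable M (\<lambda>\<omega>. \<bar>A 0 \<omega>\<bar> powr (p * p'))"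
  obtains C where "0 \<le> C" "\<And>s \<xi> \<xi>' t. 0 < s \<Longrightarrow> s \<le> smax \<Longrightarrow>
    \<bar>scattering_moment M pt A w (s, \<xi>) p (c * s, \<xi>') p' t / s powr (real DIM('a) * (p' + 1))
      - expectation (\<lambda>\<omega>. \<bar>A 0 \<omega>\<bar> powr (p * p'))
        * (\<integral>v. cmod (profile w p c (s *\<^sub>R \<xi>') v) powr p' * lam (t - s *\<^sub>R v) \<partial>lborel)\<bar>
    \<le> C * s ^ DIM('a)"
proof -
  note [measurable] = window_measurable[OF w] random_points
  have l: "0 \<le> l" using lam[of 0] by linarith
  obtain D where D: "0 < D" "\<And>t. cmod (w t) \<le> D * indicator (cbox 0 One) t"
    using window_bounded[OF w] by blast
  obtain m where m: "p * p' \<le> real m" using real_arch_simple by blast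
  obtain C where C: "0 \<le> C" and C_bd: "\<And>s \<xi> \<xi>' a x t. 0 < s \<Longrightarrow> finite {j. x j \<in> cbox (t - ((1 + c) * s) *\<^sub>R One) t} \<Longrightarrow>
    \<bar>cmod (convolve (modpow p (convolve_process (gabor w (s, \<xi>)) a x)) (gabor w (c * s, \<xi>')) t) powr p'
      - s powr (real DIM('a) * p') * (\<Sum>j | x j \<in> cbox (t - ((1 + c) * s) *\<^sub>R One) t.
          \<bar>a j\<bar> powr (p * p') * cmod (profile w p c (s *\<^sub>R \<xi>') ((t - x j) /\<^sub>R s)) powr p')\<bar>
    \<le> C * s powr (real DIM('a) * p') *
       (if 2 \<le> card {j. x j \<in> cbox (t - ((1 + c) * s) *\<^sub>R One) t}
        then real (card {j. x j \<in> cbox (t - ((1 + c) * s) *\<^sub>R One) t}) ^ m *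
          (\<Sum>j | x j \<in> cbox (t - ((1 + c) * s) *\<^sub>R One) t. \<bar>a j\<bar> powr (p * p')) else 0)"
    using scattering_single_point_approx[OF w \<open>0 < c\<close> \<open>1 \<le> p\<close> \<open>1 \<le> p'\<close> m] by blast
  define \<mu> where "\<mu> = expectation (\<lambda>\<omega>. \<bar>A 0 \<omega>\<bar> powr (p * p'))"
  have \<mu>0: "0 \<le> \<mu>" by (simp add: \<mu>_def)
  have \<mu>_nn: "(\<integral>\<^sup>+\<omega>. ennreal (\<bar>A 0 \<omega>\<bar> powr (p * p')) \<partial>M) = ennreal \<mu>"
    unfolding \<mu>_def using int by (intro nn_integral_eq_integral) auto
  \<comment> \<open>An upper bound for the intensity of every box with s <= \<open>smax\<close>; the
    summand 1 ensures R >= 1, as the tail estimate demands.\<close>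
  define R where "R = 1 + l * ((1 + c) * \<bar>smax\<bar>) ^ DIM('a)"
  have R1: "1 \<le> R" using l \<open>0 < c\<close> by (simp add: R_def)
  \<comment> \<open>The exponent is \<open>Suc m\<close>: besides the factor N(B)^m, the sum of the
    marks over the N(B) points contributes one more factor N(B) in expectation.\<close>
  define C3 where "C3 = fact (Suc m) * exp (exp 1 * R)"
  have C30: "0 \<le> C3" by (simp add: C3_def)
  show ?thesis
  proof (rule that[of "C * (\<mu> * (C3 * (l * (1 + c) ^ DIM('a))\<^sup>2))"])
    fix s :: real and \<xi> \<xi>' t :: 'a
    assume s: "0 < s" "s \<le> smax"
    define B where "B = cbox (t - ((1 + c) * s) *\<^sub>R One) t"
    have B [measurable]: "B \<in> sets borel" by (simp add: B_def)
    define J where "J \<omega> = {j. pt j \<omega> \<in> B}" for \<omega>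
    define sp where "sp = s powr (real DIM('a) * p')"
    have sp0: "0 < sp" using s by (simp add: sp_def)
    define \<phi> where "\<phi> y = cmod (profile w p c (s *\<^sub>R \<xi>') ((t - y) /\<^sub>R s)) powr p'" for y
    have \<phi>_m [measurable]: "\<phi> \<in> borel_measurable borel"
      unfolding \<phi>_def[abs_def] by measurable
    have \<phi>_out: "\<phi> y = 0" if "y \<notin> B" for y
    proof -
      have "(t - y) /\<^sub>R s \<notin> cbox 0 ((1 + c) *\<^sub>R One)"
      proof
        assume *: "(t - y) /\<^sub>R s \<in> cbox 0 ((1 + c) *\<^sub>R One)"
        have "y \<in> B"
          unfolding B_def mem_box
        proof
          fix b :: 'a assume b: "b \<in> Basis"
          have "((t - y) /\<^sub>R s) \<bullet> b = ((t - y) \<bullet> b) / s"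
            by (simp only: inner_scaleR_left divide_inverse mult.commute)
          moreover have "0 \<le> ((t - y) /\<^sub>R s) \<bullet> b" "((t - y) /\<^sub>R s) \<bullet> b \<le> 1 + c"
            using * b by (auto simp: mem_box)
          ultimately have "0 \<le> (t - y) \<bullet> b" "(t - y) \<bullet> b \<le> (1 + c) * s"
            using s by (simp_all add: zero_le_divide_iff pos_divide_le_eq)
          then show "(t - ((1 + c) * s) *\<^sub>R One) \<bullet> b \<le> y \<bullet> b \<and> y \<bullet> b \<le> t \<bullet> b"
            using b by (simp add: inner_diff_left)
        qed
        with that show False by simp
      qed
      then have "profile w p c (s *\<^sub>R \<xi>') ((t - y) /\<^sub>R s) = 0"
        using profile_le[OF D(2,1) \<open>0 < c\<close>, of p "s *\<^sub>R \<xi>'" "(t - y) /\<^sub>R s"] \<open>1 \<le> p\<close> by simp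
      then show ?thesis by (simp add: \<phi>_def)
    qed
    define D' where "D' = (D * D powr p) powr p'"
    have \<phi>_le: "\<phi> y \<le> D'" for y
    proof -
      have "cmod (profile w p c (s *\<^sub>R \<xi>') ((t - y) /\<^sub>R s)) \<le> D * D powr p * indicator (cbox 0 ((1 + c) *\<^sub>R One)) ((t - y) /\<^sub>R s)"
        using \<open>1 \<le> p\<close> by (intro profile_le[OF D(2,1) \<open>0 < c\<close>]) simp
      also have "\<dots> \<le> D * D powr p"
        using D(1) by (simp add: indicator_def)
      finally show ?thesis
        unfolding \<phi>_def D'_def using \<open>1 \<le> p'\<close> by (intro powr_mono2) auto
    qed

    define \<rho> where "\<rho> = measure (intensity_measure lam) B"
    have eB: "emeasure (intensity_measure lam) B \<le> ennreal (l * ((1 + c) * s) ^ DIM('a))"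
      unfolding B_def using s \<open>0 < c\<close> lam by (intro intensity_measure_box_le) auto
    then have eBfin: "emeasure (intensity_measure lam) B \<noteq> \<infinity>"
      by (auto simp: top_unique)
    have \<rho>0: "0 \<le> \<rho>" by (simp add: \<rho>_def)
    have \<rho>_le: "\<rho> \<le> l * ((1 + c) * s) ^ DIM('a)"
      using eB l s \<open>0 < c\<close> unfolding \<rho>_def measure_def by (intro enn2real_leI) auto
    have "l * ((1 + c) * s) ^ DIM('a) \<le> l * ((1 + c) * \<bar>smax\<bar>) ^ DIM('a)"
      using l s \<open>0 < c\<close> by (intro mult_left_mono power_mono) auto
    then have \<rho>R: "\<rho> \<le> R" using \<rho>_le by (simp add: R_def)
    have fin: "AE \<omega> in M. finite (J \<omega>)"
      unfolding J_def by (rule AE_finite_count[OF B eBfin])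

    define X where "X \<omega> = cmod (convolve
               (modpow p (convolve_process (gabor w (s, \<xi>)) (\<lambda>j. A j \<omega>) (\<lambda>j. pt j \<omega>)))
               (gabor w (c * s, \<xi>')) t) powr p'" for \<omega>
    have X_m [measurable]: "X \<in> borel_measurable M"
      using measurable_compose[OF measurable_Pair1' scattering_integrand_measurable[of w p "(s, \<xi>)" "(c * s, \<xi>')" p'], of t]
      by (simp add: X_def[abs_def])

    \<comment> \<open>The series runs over all indices instead of the random set
      \<open>J \<omega>\<close>; since \<phi> vanishes off \<open>B\<close>, both give the same
      value whenever \<open>J \<omega>\<close> is finite.\<close>
    define Z' where "Z' \<omega> = (\<Sum>j. ennreal (\<bar>A j \<omega>\<bar> powr (p * p')) * ennreal (\<phi> (pt j \<omega>)))" for \<omega>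
    define Z where "Z \<omega> = enn2real (Z' \<omega>)" for \<omega>
    have Z'_m [measurable]: "Z' \<in> borel_measurable M" unfolding Z'_def[abs_def] by measurable
    have Z_m [measurable]: "Z \<in> borel_measurable M" unfolding Z_def[abs_def] by measurable
    have Z'_fin: "Z' \<omega> = ennreal (\<Sum>j\<in>J \<omega>. \<bar>A j \<omega>\<bar> powr (p * p') * \<phi> (pt j \<omega>))" if "finite (J \<omega>)" for \<omega>
    proof -
      have "Z' \<omega> = (\<Sum>j\<in>J \<omega>. ennreal (\<bar>A j \<omega>\<bar> powr (p * p')) * ennreal (\<phi> (pt j \<omega>)))"
        unfolding Z'_def using that \<phi>_out by (intro suminf_finite) (auto simp: J_def)
      also have "\<dots> = (\<Sum>j\<in>J \<omega>. ennreal (\<bar>A j \<omega>\<bar> powr (p * p') * \<phi> (pt j \<omega>)))"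
        by (simp add: ennreal_mult \<phi>_def)
      finally show ?thesis by (subst (asm) sum_ennreal) (auto simp: \<phi>_def)
    qed
    have Z_fin: "Z \<omega> = (\<Sum>j\<in>J \<omega>. \<bar>A j \<omega>\<bar> powr (p * p') * \<phi> (pt j \<omega>))" if "finite (J \<omega>)" for \<omega>
      unfolding Z_def Z'_fin[OF that] by (intro enn2real_ennreal sum_nonneg) (auto simp: \<phi>_def)
    define I where "I = (\<integral>y. \<phi> y * lam y \<partial>lborel)"
    have I_int: "integrable lborel (\<lambda>y. \<phi> y * lam y)"
    proof (rule integrable_cbox_bound)
      show "\<bar>\<phi> y * lam y\<bar> \<le> D' * l * indicator (cbox (t - ((1 + c) * s) *\<^sub>R One) t) y" for y
      proof (cases "y \<in> B")
        case True
        then show ?thesis using \<phi>_le[of y] lam[of y] unfolding B_def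
          by (auto simp: abs_mult \<phi>_def D'_def intro!: mult_mono)
      qed (use \<phi>_out in \<open>auto simp: B_def\<close>)
    qed measurable
    have I0: "0 \<le> I" unfolding I_def using lam by (intro integral_nonneg_AE AE_I2) (auto simp: \<phi>_def)
    have Z'_int: "(\<integral>\<^sup>+\<omega>. Z' \<omega> \<partial>M) = ennreal (\<mu> * I)"
    proof -
      have "(\<integral>\<^sup>+\<omega>. Z' \<omega> \<partial>M) = (\<integral>\<^sup>+\<omega>. ennreal (\<bar>A 0 \<omega>\<bar> powr (p * p')) \<partial>M)
          * (\<integral>\<^sup>+\<omega>. (\<Sum>j. ennreal (\<phi> (pt j \<omega>))) \<partial>M)"
        unfolding Z'_def
        by (rule nn_integral_marked_sum[where h = "\<lambda>x. ennreal (\<bar>x\<bar> powr (p * p'))" and g = "\<lambda>j x. ennreal (\<phi> (x j))"]) measurable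
      also have "(\<integral>\<^sup>+\<omega>. (\<Sum>j. ennreal (\<phi> (pt j \<omega>))) \<partial>M) = (\<Sum>j. \<integral>\<^sup>+\<omega>. ennreal (\<phi> (pt j \<omega>)) \<partial>M)"
        by (rule nn_integral_suminf) measurable
      also have "\<dots> = (\<integral>\<^sup>+x. ennreal (\<phi> x) \<partial>intensity_measure lam)"
        by (rule campbell) measurable
      also have "\<dots> = (\<integral>\<^sup>+x. ennreal (lam x) * ennreal (\<phi> x) \<partial>lborel)"
        unfolding intensity_measure_def by (rule nn_integral_density) measurable
      also have "\<dots> = (\<integral>\<^sup>+x. ennreal (\<phi> x * lam x) \<partial>lborel)"
        using lam by (intro nn_integral_cong) (simp add: \<phi>_def ennreal_mult mult.commute)
      also have "\<dots> = ennreal I"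
        unfolding I_def using I_int lam by (intro nn_integral_eq_integral) (auto simp: \<phi>_def)
      finally show ?thesis using \<mu>_nn \<mu>0 I0 by (simp add: ennreal_mult)
    qed
    have Z_AE: "AE \<omega> in M. ennreal (Z \<omega>) = Z' \<omega>"
      using fin by eventually_elim (simp add: Z_def Z'_fin)
    have Z_hbi: "has_bochner_integral M Z (\<mu> * I)"
    proof (rule has_bochner_integral_nn_integral)
      have "(\<integral>\<^sup>+\<omega>. ennreal (Z \<omega>) \<partial>M) = (\<integral>\<^sup>+\<omega>. Z' \<omega> \<partial>M)"
        by (rule nn_integral_cong_AE[OF Z_AE])
      then show "(\<integral>\<^sup>+\<omega>. ennreal (Z \<omega>) \<partial>M) = ennreal (\<mu> * I)" by (simp add: Z'_int)
    qed (use \<mu>0 I0 in \<open>auto simp: Z_def\<close>)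

    define k where "k n = (if 2 \<le> n then ennreal (real n ^ m) else 0)" for n
    \<comment> \<open>The error variable, again as a series over all indices: the indicator selects
      the points of \<open>B\<close>, and \<open>count_fun B k\<close> carries N(B)^m together with
      the restriction N(B) >= 2.\<close>
    define V' where "V' \<omega> = (\<Sum>j. ennreal (\<bar>A j \<omega>\<bar> powr (p * p'))
        * (indicator B (pt j \<omega>) * count_fun B k (\<lambda>i. pt i \<omega>)))" for \<omega>
    define V where "V \<omega> = enn2real (V' \<omega>)" for \<omega>
    have V'_m [measurable]: "V' \<in> borel_measurable M" unfolding V'_def[abs_def] by measurable
    have V_m [measurable]: "V \<in> borel_measurable M" unfolding V_def[abs_def] by measurable
    have V'_fin: "V' \<omega> = ennreal (if 2 \<le> card (J \<omega>) then real (card (J \<omega>)) ^ m * (\<Sum>j\<in>J \<omega>. \<bar>A j \<omega>\<bar> powr (p * p')) else 0)"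
      if "finite (J \<omega>)" for \<omega>
    proof -
      have "V' \<omega> = (\<Sum>j\<in>J \<omega>. ennreal (\<bar>A j \<omega>\<bar> powr (p * p')) * (indicator B (pt j \<omega>) * count_fun B k (\<lambda>i. pt i \<omega>)))"
        unfolding V'_def using that by (intro suminf_finite) (auto simp: J_def)
      also have "\<dots> = (\<Sum>j\<in>J \<omega>. ennreal (\<bar>A j \<omega>\<bar> powr (p * p')) * k (card (J \<omega>)))"
        using that by (intro sum.cong) (auto simp: J_def count_fun_eq[OF B])
      also have "\<dots> = (\<Sum>j\<in>J \<omega>. ennreal (\<bar>A j \<omega>\<bar> powr (p * p'))) * k (card (J \<omega>))"
        by (rule sum_distrib_right[symmetric])
      also have "\<dots> = k (card (J \<omega>)) * ennreal (\<Sum>j\<in>J \<omega>. \<bar>A j \<omega>\<bar> powr (p * p'))"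
        by (subst sum_ennreal) (auto simp: mult.commute)
      finally show ?thesis
        by (auto simp: k_def ennreal_mult sum_nonneg)
    qed
    have V_fin: "V \<omega> = (if 2 \<le> card (J \<omega>) then real (card (J \<omega>)) ^ m * (\<Sum>j\<in>J \<omega>. \<bar>A j \<omega>\<bar> powr (p * p')) else 0)"
      if "finite (J \<omega>)" for \<omega>
      unfolding V_def V'_fin[OF that] by (intro enn2real_ennreal) (auto intro!: sum_nonneg mult_nonneg_nonneg)
    have V'_int: "(\<integral>\<^sup>+\<omega>. V' \<omega> \<partial>M) \<le> ennreal (\<mu> * (C3 * \<rho>\<^sup>2))"
    proof -
      have "(\<integral>\<^sup>+\<omega>. V' \<omega> \<partial>M) = (\<integral>\<^sup>+\<omega>. ennreal (\<bar>A 0 \<omega>\<bar> powr (p * p')) \<partial>M)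
          * (\<integral>\<^sup>+\<omega>. (\<Sum>j. indicator B (pt j \<omega>) * count_fun B k (\<lambda>i. pt i \<omega>)) \<partial>M)"
        unfolding V'_def
        by (rule nn_integral_marked_sum[where h = "\<lambda>x. ennreal (\<bar>x\<bar> powr (p * p'))" and g = "\<lambda>j x. indicator B (x j) * count_fun B k x"]) measurable
      also have "(\<integral>\<^sup>+\<omega>. (\<Sum>j. indicator B (pt j \<omega>) * count_fun B k (\<lambda>i. pt i \<omega>)) \<partial>M)
          = (\<integral>\<^sup>+\<omega>. count_fun B (\<lambda>n. if 2 \<le> n then ennreal (real n ^ Suc m) else 0) (\<lambda>i. pt i \<omega>) \<partial>M)"
      proof (rule nn_integral_cong_AE, use fin in eventually_elim)
        fix \<omega> assume J: "finite (J \<omega>)"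
        have "(\<Sum>j. indicator B (pt j \<omega>) * count_fun B k (\<lambda>i. pt i \<omega>))
            = (\<Sum>j\<in>J \<omega>. indicator B (pt j \<omega>) * count_fun B k (\<lambda>i. pt i \<omega>))"
          using J by (intro suminf_finite) (auto simp: J_def)
        also have "\<dots> = (\<Sum>j\<in>J \<omega>. k (card (J \<omega>)))"
          using J by (intro sum.cong) (auto simp: J_def count_fun_eq[OF B])
        also have "\<dots> = (if 2 \<le> card (J \<omega>) then ennreal (real (card (J \<omega>)) ^ Suc m) else 0)"
          by (simp add: k_def ennreal_mult ennreal_of_nat_eq_real_of_nat)
        finally show "(\<Sum>j. indicator B (pt j \<omega>) * count_fun B k (\<lambda>i. pt i \<omega>))
            = count_fun B (\<lambda>n. if 2 \<le> n then ennreal (real n ^ Suc m) else 0) (\<lambda>i. pt i \<omega>)"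
          using J by (simp add: count_fun_eq[OF B] J_def)
      qed
      also have "\<dots> = (\<Sum>n. (if 2 \<le> n then ennreal (real n ^ Suc m) else 0) * ennreal (exp (- \<rho>) * \<rho> ^ n / fact n))"
        using eBfin unfolding nn_integral_count_fun[OF B] \<rho>_def by simp
      also have "\<dots> \<le> ennreal (C3 * \<rho>\<^sup>2)"
        unfolding C3_def by (rule poisson_tail_moment_le[OF \<rho>0 \<rho>R R1])
      finally show ?thesis
        using \<mu>0 C30 by (simp add: \<mu>_nn ennreal_mult mult_left_mono)
    qed
    have V_int: "integrable M V" "expectation V \<le> \<mu> * (C3 * \<rho>\<^sup>2)"
    proof -
      \<comment> \<open>\<open>enn2real\<close> sends infinity to 0, so
        \<open>ennreal (enn2real x)\<close> never exceeds x; an upper bound therefore needs no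
        almost-everywhere argument here.\<close>
      have "(\<integral>\<^sup>+\<omega>. ennreal (V \<omega>) \<partial>M) \<le> (\<integral>\<^sup>+\<omega>. V' \<omega> \<partial>M)"
        unfolding V_def by (intro nn_integral_mono ennreal_enn2real_if[THEN eq_refl, THEN order_trans]) auto
      then have le: "(\<integral>\<^sup>+\<omega>. ennreal (V \<omega>) \<partial>M) \<le> ennreal (\<mu> * (C3 * \<rho>\<^sup>2))"
        using V'_int by (rule order_trans)
      show "integrable M V"
        by (rule integrableI_nonneg) (use le in \<open>auto simp: V_def intro: le_less_trans\<close>)
      then have "ennreal (expectation V) = (\<integral>\<^sup>+\<omega>. ennreal (V \<omega>) \<partial>M)"
        by (intro nn_integral_eq_integral[symmetric]) (auto simp: V_def)
      with le have "ennreal (expectation V) \<le> ennreal (\<mu> * (C3 * \<rho>\<^sup>2))" by (simp only:)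
      then show "expectation V \<le> \<mu> * (C3 * \<rho>\<^sup>2)"
        using ennreal_le_iff[of "\<mu> * (C3 * \<rho>\<^sup>2)"] \<mu>0 C30 by (metis mult_nonneg_nonneg zero_le_power2)
    qed

    have diff: "AE \<omega> in M. \<bar>X \<omega> - sp * Z \<omega>\<bar> \<le> C * sp * V \<omega>"
      using fin
    proof eventually_elim
      fix \<omega> assume J: "finite (J \<omega>)"
      show "\<bar>X \<omega> - sp * Z \<omega>\<bar> \<le> C * sp * V \<omega>"
        using C_bd[of s "\<lambda>j. pt j \<omega>" t \<xi> "\<lambda>j. A j \<omega>" \<xi>'] s(1) J
        unfolding Z_fin[OF J] V_fin[OF J] X_def sp_def J_def \<phi>_def B_def by simp
    qed
    have Z_int: "integrable M Z" "expectation Z = \<mu> * I"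
      using Z_hbi by (auto simp: has_bochner_integral_iff)
    have XZ_int: "integrable M (\<lambda>\<omega>. X \<omega> - sp * Z \<omega>)"
    proof (rule Bochner_Integration.integrable_bound)
      show "integrable M (\<lambda>\<omega>. C * sp * V \<omega>)" using V_int by simp
      show "AE \<omega> in M. norm (X \<omega> - sp * Z \<omega>) \<le> norm (C * sp * V \<omega>)"
        using diff by eventually_elim simp
    qed measurable
    \<comment> \<open>Integrability of the scattering integrand comes out of the comparison itself,
      by writing X = (X - sp Z) + sp Z. It is needed to split the expectation, since a
      non-integrable X would have expectation 0 by default.\<close>
    have X_int: "integrable M X"
      using Bochner_Integration.integrable_add[OF XZ_int integrable_mult_right[OF Z_int(1), of sp]] by simp
    have "\<bar>expectation X - sp * (\<mu> * I)\<bar> = \<bar>expectation (\<lambda>\<omega>. X \<omega> - sp * Z \<omega>)\<bar>"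
      using X_int Z_int by simp
    also have "\<dots> \<le> expectation (\<lambda>\<omega>. \<bar>X \<omega> - sp * Z \<omega>\<bar>)"
      by (rule integral_abs_bound)
    also have "\<dots> \<le> expectation (\<lambda>\<omega>. C * sp * V \<omega>)"
      using XZ_int V_int diff by (intro integral_mono_AE) auto
    also have "\<dots> = C * sp * expectation V" by simp
    also have "\<dots> \<le> C * sp * (\<mu> * (C3 * \<rho>\<^sup>2))"
      using V_int C sp0 by (intro mult_left_mono) auto
    also have "\<dots> \<le> C * sp * (\<mu> * (C3 * (l * ((1 + c) * s) ^ DIM('a))\<^sup>2))"
      using C sp0 \<mu>0 C30 \<rho>0 \<rho>_le by (intro mult_left_mono power_mono) auto
    \<comment> \<open>Of the s^(2d) coming from \<rho>^2, one factor s^d belongs to the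
      normalisation s^(d(p'+1)) and the other remains as the rate of convergence.\<close>
    also have "\<dots> = sp * s ^ DIM('a) * (C * (\<mu> * (C3 * (l * (1 + c) ^ DIM('a))\<^sup>2)) * s ^ DIM('a))"
      by (simp add: power_mult_distrib power2_eq_square)
    finally have bd: "\<bar>expectation X - sp * (\<mu> * I)\<bar> \<le> \<dots>" .

    \<comment> \<open>The substitution y = t - s v moves the scale out of the profile and into the
      argument of the intensity, where continuity of \<open>lam\<close> will remove it.\<close>
    have "I = s ^ DIM('a) *\<^sub>R (\<integral>v. \<phi> (t + (- s) *\<^sub>R v) * lam (t + (- s) *\<^sub>R v) \<partial>lborel)"
      unfolding I_def using lborel_integral_affine_euclidean[of "\<lambda>y. \<phi> y * lam y" "- s" t] s by simp
    then have I_eq: "I = s ^ DIM('a) * (\<integral>v. cmod (profile w p c (s *\<^sub>R \<xi>') v) powr p' * lam (t - s *\<^sub>R v) \<partial>lborel)"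
      using s by (simp add: \<phi>_def)
    define I' where "I' = (\<integral>v. cmod (profile w p c (s *\<^sub>R \<xi>') v) powr p' * lam (t - s *\<^sub>R v) \<partial>lborel)"
    have spd: "s powr (real DIM('a) * (p' + 1)) = sp * s ^ DIM('a)"
      using s by (simp add: sp_def distrib_left powr_add powr_realpow)
    have pos: "0 < sp * s ^ DIM('a)" using sp0 s by simp
    have "expectation X / (sp * s ^ DIM('a)) - \<mu> * I' = (expectation X - sp * (\<mu> * I)) / (sp * s ^ DIM('a))"
      using sp0 s unfolding I_eq I'_def[symmetric] by (simp add: field_simps)
    then have "\<bar>expectation X / (sp * s ^ DIM('a)) - \<mu> * I'\<bar> = \<bar>expectation X - sp * (\<mu> * I)\<bar> / (sp * s ^ DIM('a))"
      using pos by (simp add: abs_divide)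
    also have "\<dots> \<le> C * (\<mu> * (C3 * (l * (1 + c) ^ DIM('a))\<^sup>2)) * s ^ DIM('a)"
      using bd pos by (simp add: pos_divide_le_eq mult.commute)
    finally show "\<bar>scattering_moment M pt A w (s, \<xi>) p (c * s, \<xi>') p' t / s powr (real DIM('a) * (p' + 1))
      - expectation (\<lambda>\<omega>. \<bar>A 0 \<omega>\<bar> powr (p * p'))
        * (\<integral>v. cmod (profile w p c (s *\<^sub>R \<xi>') v) powr p' * lam (t - s *\<^sub>R v) \<partial>lborel)\<bar>
      \<le> C * (\<mu> * (C3 * (l * (1 + c) ^ DIM('a))\<^sup>2)) * s ^ DIM('a)"
      unfolding scattering_moment_def spd X_def \<mu>_def I'_def .
  qed (use C C30 \<mu>0 in simp)
qed

end

theorem theorem4: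
  fixes M :: "'w measure"
    and lam :: "'a::euclidean_space \<Rightarrow> real"
    and pt :: "nat \<Rightarrow> 'w \<Rightarrow> 'a"
    and A :: "nat \<Rightarrow> 'w \<Rightarrow> real"
    and w :: "'a \<Rightarrow> complex"
    and s s' :: "nat \<Rightarrow> real" and \<xi> \<xi>' :: "nat \<Rightarrow> 'a"
    and L :: 'a
    and T c p p' q K :: real
  assumes "window w"
    and "T > 0" and "coord_periodic T lam" and "continuous_on UNIV lam"
    and "0 < (INF t. ereal (lam t))" and "(SUP t. ereal \<bar>lam t\<bar>) < \<infinity>"
    and "compound_poisson_process M lam pt A"
    and "\<And>k. s k > 0" and "c > 0" and "\<And>k. s' k = c * s k"
    and "s \<longlonglongrightarrow> 0" and "(\<lambda>k. s' k *\<^sub>R \<xi>' k) \<longlonglongrightarrow> L"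
    and "1 \<le> p" and "1 \<le> p'" and "q = p * p'"
    and "integrable M (\<lambda>\<omega>. \<bar>A 0 \<omega>\<bar> powr q)"
    and "K = Lp_norm p' (convolve (gabor w (c, L /\<^sub>R c)) (modpow p (gabor w (1, 0)))) powr p'"
  shows "(\<forall>t. (\<lambda>k. scattering_moment M pt A w (s k, \<xi> k) p (s' k, \<xi>' k) p' t
                     / s k powr (real DIM('a) * (p' + 1)))
               \<longlonglongrightarrow> K * lam t * prob_space.expectation M (\<lambda>\<omega>. \<bar>A 0 \<omega>\<bar> powr q))
       \<and> (\<lambda>k. invariant_scattering_moment M pt A w T (s k, \<xi> k) p (s' k, \<xi>' k) p'
                / s k powr (real DIM('a) * (p' + 1)))
           \<longlonglongrightarrow> K * cube_mean T lam * prob_space.expectation M (\<lambda>\<omega>. \<bar>A 0 \<omega>\<bar> powr q)"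
proof -
  interpret compound_poisson_process M lam pt A by fact
  note [measurable] = window_measurable[OF \<open>window w\<close>]
  have lam_m [measurable]: "lam \<in> borel_measurable borel"
    by (intro borel_measurable_continuous_onI) fact
  obtain n where n: "(SUP t. ereal \<bar>lam t\<bar>) < ereal (real n)"
    using assms(6) less_PInf_Ex_of_nat by auto
  have lam: "0 \<le> lam t" "lam t \<le> real n" for t
  proof -
    have "0 < ereal (lam t)" by (rule less_le_trans[OF assms(5)]) (rule INF_lower, simp)
    then show "0 \<le> lam t" by simp
    have "ereal \<bar>lam t\<bar> < ereal (real n)" by (rule le_less_trans[OF _ n]) (rule SUP_upper, simp)
    then show "lam t \<le> real n" by simp
  qed
  obtain D where D: "0 < D" "\<And>t. cmod (w t) \<le> D * indicator (cbox 0 One) t"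
    using window_bounded[OF \<open>window w\<close>] by blast
  \<comment> \<open>A convergent sequence is bounded, so the uniform estimate is available for every
    k and not only eventually, as dominated convergence requires.\<close>
  obtain smax where smax: "\<And>k. s k \<le> smax"
    using convergent_imp_Bseq[OF convergentI[OF \<open>s \<longlonglongrightarrow> 0\<close>]] unfolding Bseq_def
    by (metis abs_ge_self order_trans real_norm_def)
  define \<mu> where "\<mu> = expectation (\<lambda>\<omega>. \<bar>A 0 \<omega>\<bar> powr q)"
  have \<mu>0: "0 \<le> \<mu>" by (simp add: \<mu>_def)
  define I where "I k t = (\<integral>v. cmod (profile w p c (s k *\<^sub>R \<xi>' k) v) powr p' * lam (t - s k *\<^sub>R v) \<partial>lborel)" for k t
  define r where "r k t = scattering_moment M pt A w (s k, \<xi> k) p (s' k, \<xi>' k) p' t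
                     / s k powr (real DIM('a) * (p' + 1))" for k t
  obtain C where C: "0 \<le> C" "\<And>k t. \<bar>r k t - \<mu> * I k t\<bar> \<le> C * s k ^ DIM('a)"
  proof -
    obtain C where "0 \<le> C" and C: "\<And>s \<xi> \<xi>' t. 0 < s \<Longrightarrow> s \<le> smax \<Longrightarrow>
      \<bar>scattering_moment M pt A w (s, \<xi>) p (c * s, \<xi>') p' t / s powr (real DIM('a) * (p' + 1))
        - expectation (\<lambda>\<omega>. \<bar>A 0 \<omega>\<bar> powr (p * p'))
          * (\<integral>v. cmod (profile w p c (s *\<^sub>R \<xi>') v) powr p' * lam (t - s *\<^sub>R v) \<partial>lborel)\<bar>
      \<le> C * s ^ DIM('a)"
      using scattering_moment_approx[OF \<open>window w\<close> lam_m lam \<open>0 < c\<close> \<open>1 \<le> p\<close> \<open>1 \<le> p'\<close>, of smax] assms(16)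
      unfolding \<open>q = p * p'\<close> by blast
    show ?thesis
      by (rule that[OF \<open>0 \<le> C\<close>])
        (use C[OF assms(8) smax] in \<open>simp add: r_def I_def \<mu>_def assms(10,15)\<close>)
  qed
  \<comment> \<open>The largest possible value of the integrand: the sup bound of the profile to the
    power p', times the upper bound of the intensity.\<close>
  define E where "E = (D * D powr p) powr p' * real n"
  have E0: "0 \<le> E" by (simp add: E_def)
  have integrand_le: "norm (cmod (profile w p c \<eta> v) powr p' * lam x) \<le> E * indicator (cbox 0 ((1 + c) *\<^sub>R One)) v" for \<eta> v x
  proof (cases "v \<in> cbox 0 ((1 + c) *\<^sub>R One)")
    case True
    have "cmod (profile w p c \<eta> v) \<le> D * D powr p"
      using profile_le[OF D(2,1) \<open>0 < c\<close>, of p \<eta> v] True \<open>1 \<le> p\<close> by simp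
    then have "cmod (profile w p c \<eta> v) powr p' \<le> (D * D powr p) powr p'"
      using \<open>1 \<le> p'\<close> by (intro powr_mono2) auto
    then show ?thesis
      using True lam[of x] by (auto simp: E_def abs_mult intro!: mult_mono)
  next
    case False
    then have "profile w p c \<eta> v = 0"
      using profile_le[OF D(2,1) \<open>0 < c\<close>, of p \<eta> v] \<open>1 \<le> p\<close> by simp
    then show ?thesis using False by simp
  qed
  have I_le: "\<bar>I k t\<bar> \<le> E * (1 + c) ^ DIM('a)" for k t
  proof -
    have "norm (I k t) \<le> E * measure lborel (cbox 0 ((1 + c) *\<^sub>R One :: 'a))"
      unfolding I_def by (rule norm_integral_le_indicator[OF _ _ E0 integrand_le])
        (use emeasure_lborel_cbox_finite in auto)
    also have "measure lborel (cbox 0 ((1 + c) *\<^sub>R One :: 'a)) = (1 + c) ^ DIM('a)"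
      using content_cbox_scaleR_One[of "1 + c" "0::'a"] \<open>0 < c\<close> by simp
    finally show ?thesis by simp
  qed
  have K: "K = (\<integral>v. cmod (profile w p c (L /\<^sub>R c) v) powr p' \<partial>lborel)"
    unfolding assms(17) profile_def[symmetric] Lp_norm_def using \<open>1 \<le> p'\<close>
    by (simp add: powr_powr)
  \<comment> \<open>The hypothesis concerns s' \<xi>', while the profile sees s \<xi>'; dividing by
    c turns the limit L into the frequency L/c of K.\<close>
  have \<eta>: "(\<lambda>k. s k *\<^sub>R \<xi>' k) \<longlonglongrightarrow> L /\<^sub>R c"
  proof -
    have e: "inverse c *\<^sub>R s' k *\<^sub>R \<xi>' k = s k *\<^sub>R \<xi>' k" for k
      using \<open>0 < c\<close> by (simp add: assms(10))
    show ?thesis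
      using tendsto_scaleR[OF tendsto_const[of "inverse c"] assms(12)] unfolding e .
  qed
  have I_lim: "(\<lambda>k. I k t) \<longlonglongrightarrow> K * lam t" for t
  proof -
    have "(\<lambda>k. I k t) \<longlonglongrightarrow> (\<integral>v. cmod (profile w p c (L /\<^sub>R c) v) powr p' * lam t \<partial>lborel)"
      unfolding I_def
    proof (rule integral_dominated_convergence[where w = "\<lambda>v. E * indicator (cbox 0 ((1 + c) *\<^sub>R One)) v"])
      show "integrable lborel (\<lambda>v::'a. E * indicator (cbox 0 ((1 + c) *\<^sub>R One)) v)"
        by (rule integrable_cbox_bound) (use E0 in \<open>auto simp: abs_mult\<close>)
      have "(\<lambda>k. cmod (profile w p c (s k *\<^sub>R \<xi>' k) v) powr p' * lam (t - s k *\<^sub>R v))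
        \<longlonglongrightarrow> cmod (profile w p c (L /\<^sub>R c) v) powr p' * lam t" for v
      proof (intro tendsto_mult tendsto_powr')
        show "(\<lambda>k. cmod (profile w p c (s k *\<^sub>R \<xi>' k) v)) \<longlonglongrightarrow> cmod (profile w p c (L /\<^sub>R c) v)"
          using \<open>1 \<le> p\<close> by (intro tendsto_norm profile_tendsto[OF \<open>window w\<close> \<open>0 < c\<close> _ \<eta>]) simp
        have "(\<lambda>k. t - s k *\<^sub>R v) \<longlonglongrightarrow> t - 0 *\<^sub>R v"
          by (intro tendsto_intros \<open>s \<longlonglongrightarrow> 0\<close>)
        then show "(\<lambda>k. lam (t - s k *\<^sub>R v)) \<longlonglongrightarrow> lam t"
          using continuous_on_tendsto_compose[OF \<open>continuous_on UNIV lam\<close>] by force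
      qed (use \<open>1 \<le> p'\<close> in auto)
      then show "AE v in lborel. (\<lambda>k. cmod (profile w p c (s k *\<^sub>R \<xi>' k) v) powr p' * lam (t - s k *\<^sub>R v))
        \<longlonglongrightarrow> cmod (profile w p c (L /\<^sub>R c) v) powr p' * lam t"
        by simp
    qed (use integrand_le in auto)
    then show ?thesis by (simp add: K)
  qed
  have r_lim: "(\<lambda>k. r k t) \<longlonglongrightarrow> K * lam t * \<mu>" for t
  proof -
    have "(\<lambda>k. C * s k ^ DIM('a)) \<longlonglongrightarrow> C * 0 ^ DIM('a)"
      by (intro tendsto_intros \<open>s \<longlonglongrightarrow> 0\<close>)
    \<comment> \<open>The dimension of a Euclidean space is positive, so the error rate s^d really
      tends to 0.\<close>
    moreover have "C * 0 ^ DIM('a) = 0" by (simp add: power_0_left)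
    ultimately have "(\<lambda>k. C * s k ^ DIM('a)) \<longlonglongrightarrow> 0" by (simp only:)
    then have "(\<lambda>k. r k t - \<mu> * I k t) \<longlonglongrightarrow> 0"
      by (rule Lim_null_comparison[rotated]) (use C(2) in auto)
    from tendsto_add[OF this tendsto_mult[OF tendsto_const[of \<mu>] I_lim[of t]]]
    show ?thesis by (simp add: mult_ac)
  qed
  \<comment> \<open>A bound on the normalised moments uniform in k and t, obtained from the error at
    the largest scale plus the bound on the main term; on the bounded period cube this constant is
    an integrable majorant.\<close>
  define H where "H = C * smax ^ DIM('a) + \<mu> * (E * (1 + c) ^ DIM('a))"
  have r_le: "\<bar>r k t\<bar> \<le> H" for k t
  proof -
    have "\<bar>r k t\<bar> \<le> \<bar>r k t - \<mu> * I k t\<bar> + \<bar>\<mu> * I k t\<bar>" by linarith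
    also have "\<dots> \<le> H"
      unfolding H_def
    proof (rule add_mono)
      have "C * s k ^ DIM('a) \<le> C * smax ^ DIM('a)"
        using C(1) assms(8)[of k] smax[of k] by (intro mult_left_mono power_mono) auto
      then show "\<bar>r k t - \<mu> * I k t\<bar> \<le> C * smax ^ DIM('a)" using C(2)[of k t] by linarith
      show "\<bar>\<mu> * I k t\<bar> \<le> \<mu> * (E * (1 + c) ^ DIM('a))"
        using \<mu>0 I_le[of k t] by (simp add: abs_mult mult_left_mono)
    qed
    finally show ?thesis .
  qed
  have r_m [measurable]: "r k \<in> borel_measurable borel" for k
    using scattering_moment_measurable[of w "(s k, \<xi> k)" p "(s' k, \<xi>' k)" p'] unfolding r_def[abs_def] by simp
  define Q where "Q = cbox 0 (T *\<^sub>R One :: 'a)"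
  have "(\<lambda>k. \<integral>t. indicator Q t *\<^sub>R r k t \<partial>lborel) \<longlonglongrightarrow> (\<integral>t. indicator Q t *\<^sub>R (K * lam t * \<mu>) \<partial>lborel)"
  proof (rule integral_dominated_convergence[where w = "\<lambda>t. H * indicator Q t"])
    have H0: "0 \<le> H" using r_le[of 0 0] by linarith
    show "integrable lborel (\<lambda>t. H * indicator Q t)"
      unfolding Q_def by (rule integrable_cbox_bound) (use H0 in \<open>auto simp: abs_mult\<close>)
    show "AE t in lborel. norm (indicator Q t *\<^sub>R r k t) \<le> H * indicator Q t" for k
      using r_le by (intro AE_I2) (simp add: indicator_def)
    show "AE t in lborel. (\<lambda>k. indicator Q t *\<^sub>R r k t) \<longlonglongrightarrow> indicator Q t *\<^sub>R (K * lam t * \<mu>)"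
      by (intro AE_I2 tendsto_scaleR tendsto_const r_lim)
  qed (simp_all add: Q_def)
  then have "(\<lambda>k. 1 / T ^ DIM('a) * (\<integral>t. indicator Q t *\<^sub>R r k t \<partial>lborel))
      \<longlonglongrightarrow> 1 / T ^ DIM('a) * (\<integral>t. indicator Q t *\<^sub>R (K * lam t * \<mu>) \<partial>lborel)"
    by (intro tendsto_mult tendsto_const)
  moreover have "1 / T ^ DIM('a) * (\<integral>t. indicator Q t *\<^sub>R r k t \<partial>lborel)
      = invariant_scattering_moment M pt A w T (s k, \<xi> k) p (s' k, \<xi>' k) p' / s k powr (real DIM('a) * (p' + 1))" for k
    by (simp add: invariant_scattering_moment_def cube_mean_def set_lebesgue_integral_def Q_def r_def)
  moreover have "1 / T ^ DIM('a) * (\<integral>t. indicator Q t *\<^sub>R (K * lam t * \<mu>) \<partial>lborel) = K * cube_mean T lam * \<mu>"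
  proof -
    have "(\<integral>t. indicator Q t *\<^sub>R (K * lam t * \<mu>) \<partial>lborel) = (\<integral>t. (K * \<mu>) * (indicator Q t *\<^sub>R lam t) \<partial>lborel)"
      by (simp add: mult_ac)
    also have "\<dots> = (K * \<mu>) * (\<integral>t. indicator Q t *\<^sub>R lam t \<partial>lborel)"
      by (rule integral_mult_right_zero)
    finally show ?thesis
      by (simp add: cube_mean_def set_lebesgue_integral_def Q_def mult_ac)
  qed
  ultimately show ?thesis
    using r_lim unfolding r_def \<mu>_def by simp
qed

end
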